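(* Assume that: (H1) (i) there is a constant $L_1>0$ such that $|b(x,a)-b(x',a')|+\|\sigma(x,a)-\sigma(x',a')\|\le L_1(|x-x'|+|a-a'|)$ for all $x,x'\in\mathbb{R}^d$, $a,a'\in\mathbb{R}^q$; (ii) there is a constant $\gamma>0$ such that $(x-x').(b(x,a)-b(x',a))+\frac12\|\sigma(x,a)-\sigma(x',a)\|^2\le-\gamma|x-x'|^2$ for all $x,x'\in\mathbb{R}^d$, $a\in A$; (H2) (i) there is a constant $L_2>0$ such that $|f(x,a,y)-f(x',a',y')|\le L_2(|x-x'|+|a-a'|+|y-y'|)$ for all $x,x'\in\mathbb{R}^d$, $a,a'\in\mathbb{R}^q$, $y,y'\in\mathbb{R}$; (ii) $y\mapsto f(x,a,y)$ is nonincreasing for all $(x,a)\in\mathbb{R}^d\times\mathbb{R}^q$; (HA) the interior $\mathring{A}$ of $A$ is connected and $A$ is the closure of $\mathring{A}$; (H$\vartheta$) the measure $\vartheta$ supports the whole set $\mathring{A}$ and the boundary $\partial A=A\setminus\mathring{A}$ is $\vartheta$-negligible. Then there exists a viscosity solution pair $(\lambda,\phi)$, with $\lambda\in\mathbb{R}$ and $\phi$ Lipschitz on $\mathbb{R}^d$, to the ergodic equation $$\lambda-\sup_{a\in A}\big[\mathcal{L}^a\phi+f(x,a,\lambda)\big]=0\quad\text{on }\mathbb{R}^d.$$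
   Context: $A$ is a compact subset of $\mathbb{R}^q$ and $\vartheta$ is a finite measure on $A$ with its Borel $\sigma$-field. The functions $b:\mathbb{R}^d\times\mathbb{R}^q\to\mathbb{R}^d$, $\sigma:\mathbb{R}^d\times\mathbb{R}^q\to\mathbb{R}^{d\times d}$ and $f:\mathbb{R}^d\times\mathbb{R}^q\times\mathbb{R}\to\mathbb{R}$ are continuous. $\|M\|^2=\mathrm{tr}(MM^{\top})$, and $x.y$ denotes the Euclidean inner product. For $a\in A$, $$\mathcal{L}^a\varphi(x)=b(x,a).D_x\varphi(x)+\tfrac12\mathrm{tr}\big(\sigma\sigma^{\top}(x,a)D_x^2\varphi(x)\big).$$ Viscosity solution of the ergodic equation: a pair $(\lambda,\phi)$ with $\lambda\in\mathbb{R}$ and $\phi:\mathbb{R}^d\to\mathbb{R}$ lower (resp. upper) semicontinuous is a viscosity supersolution (resp. subsolution) if $\lambda\ge$ (resp. $\le$) $\sup_{a\in A}[\mathcal{L}^a\varphi(x)+f(x,a,\lambda)]$ for any $x\in\mathbb{R}^d$ and any $\varphi\in C^2(\mathbb{R}^d)$ such that $(\phi-\varphi)(x)=\min_{\mathbb{R}^d}(\phi-\varphi)$ (resp. $\max_{\mathbb{R}^d}(\phi-\varphi)$). A pair $(\lambda,\phi)$ with $\phi:\mathbb{R}^d\to\mathbb{R}$ continuous is a viscosity solution if it is both a supersolution and a subsolution. *)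

theory Defs
  imports "HOL-Analysis.Analysis"
begin

(* On real^'n^'m the library norm is the Frobenius norm, so norm M is the matrix
   norm with norm M ^ 2 = tr (M M^T). *)
lemma norm_matrix_square_eq_trace:
  fixes M :: "real ^ 'n ^ 'm"
  shows "(norm M)\<^sup>2 = trace (M ** transpose M)"
  by (simp add: power2_norm_eq_inner inner_vec_def trace_def matrix_matrix_mult_def transpose_def)

definition lower_semicontinuous :: "('a::topological_space \<Rightarrow> real) \<Rightarrow> bool" where
  "lower_semicontinuous u \<longleftrightarrow> (\<forall>x. \<forall>c<u x. \<forall>\<^sub>F y in at x. c < u y)"

definition upper_semicontinuous :: "('a::topological_space \<Rightarrow> real) \<Rightarrow> bool" where
  "upper_semicontinuous u \<longleftrightarrow> (\<forall>x. \<forall>c>u x. \<forall>\<^sub>F y in at x. u y < c)"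

(* Meaningful only where \<phi> is differentiable. *)
definition grad :: "('a::real_inner \<Rightarrow> real) \<Rightarrow> 'a \<Rightarrow> 'a" where
  "grad \<phi> x = (THE D. GDERIV \<phi> x :> D)"

definition hess :: "(real ^ 'd \<Rightarrow> real) \<Rightarrow> real ^ 'd \<Rightarrow> real ^ 'd ^ 'd" where
  "hess \<phi> x = jacobian (grad \<phi>) (at x)"

definition C2 :: "(real ^ 'd \<Rightarrow> real) \<Rightarrow> bool" where
  "C2 \<phi> \<longleftrightarrow> (\<forall>x. \<phi> differentiable (at x)) \<and> (\<forall>x. grad \<phi> differentiable (at x))
             \<and> continuous_on UNIV (hess \<phi>)"

lemma grad_eq:
  assumes "GDERIV \<phi> x :> D"
  shows "grad \<phi> x = D"
  unfolding grad_def
proof (rule the_equality)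
  show "GDERIV \<phi> x :> D" by fact
  fix D' assume "GDERIV \<phi> x :> D'"
  then have "(\<lambda>h. h \<bullet> D') = (\<lambda>h. h \<bullet> D)"
    using assms unfolding gderiv_def by (rule has_derivative_unique)
  then have "\<forall>h. h \<bullet> D' = h \<bullet> D"
    by meson
  then show "D' = D"
    by (simp add: vector_eq_ldot)
qed

lemma differentiable_imp_grad:
  fixes \<phi> :: "'a::euclidean_space \<Rightarrow> real"
  assumes "\<phi> differentiable (at x)"
  shows "GDERIV \<phi> x :> grad \<phi> x"
proof -
  from assms obtain \<phi>' where D: "(\<phi> has_derivative \<phi>') (at x)"
    unfolding differentiable_def by blast
  then have "linear \<phi>'"
    by (rule has_derivative_linear)
  then have "\<phi>' = (\<lambda>h. h \<bullet> adjoint \<phi>' 1)"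
    using adjoint_works[of \<phi>' _ 1] by auto
  then have "GDERIV \<phi> x :> adjoint \<phi>' 1"
    using D unfolding gderiv_def by simp
  then show ?thesis
    using grad_eq by metis
qed

definition generator ::
  "(real ^ 'd \<Rightarrow> real ^ 'q \<Rightarrow> real ^ 'd) \<Rightarrow> (real ^ 'd \<Rightarrow> real ^ 'q \<Rightarrow> real ^ 'd ^ 'd)
    \<Rightarrow> real ^ 'q \<Rightarrow> (real ^ 'd \<Rightarrow> real) \<Rightarrow> real ^ 'd \<Rightarrow> real" where
  "generator b \<sigma> a \<phi> x =
     b x a \<bullet> grad \<phi> x + 1 / 2 * trace (\<sigma> x a ** transpose (\<sigma> x a) ** hess \<phi> x)"

(* The real-valued SUP in the next two definitions is the mathematical supremum
   whenever A is nonempty and compact and b, \<sigma>, f are continuous. *)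
definition viscosity_supersolution ::
  "(real ^ 'd \<Rightarrow> real ^ 'q \<Rightarrow> real ^ 'd) \<Rightarrow> (real ^ 'd \<Rightarrow> real ^ 'q \<Rightarrow> real ^ 'd ^ 'd)
    \<Rightarrow> (real ^ 'd \<Rightarrow> real ^ 'q \<Rightarrow> real \<Rightarrow> real) \<Rightarrow> (real ^ 'q) set
    \<Rightarrow> real \<Rightarrow> (real ^ 'd \<Rightarrow> real) \<Rightarrow> bool" where
  "viscosity_supersolution b \<sigma> f A lam \<phi> \<longleftrightarrow>
     lower_semicontinuous \<phi> \<and>
     (\<forall>x \<psi>. C2 \<psi> \<longrightarrow> (\<forall>y. \<phi> x - \<psi> x \<le> \<phi> y - \<psi> y) \<longrightarrow>
        lam \<ge> (SUP a\<in>A. generator b \<sigma> a \<psi> x + f x a lam))"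

definition viscosity_subsolution ::
  "(real ^ 'd \<Rightarrow> real ^ 'q \<Rightarrow> real ^ 'd) \<Rightarrow> (real ^ 'd \<Rightarrow> real ^ 'q \<Rightarrow> real ^ 'd ^ 'd)
    \<Rightarrow> (real ^ 'd \<Rightarrow> real ^ 'q \<Rightarrow> real \<Rightarrow> real) \<Rightarrow> (real ^ 'q) set
    \<Rightarrow> real \<Rightarrow> (real ^ 'd \<Rightarrow> real) \<Rightarrow> bool" where
  "viscosity_subsolution b \<sigma> f A lam \<phi> \<longleftrightarrow>
     upper_semicontinuous \<phi> \<and>
     (\<forall>x \<psi>. C2 \<psi> \<longrightarrow> (\<forall>y. \<phi> y - \<psi> y \<le> \<phi> x - \<psi> x) \<longrightarrow>
        lam \<le> (SUP a\<in>A. generator b \<sigma> a \<psi> x + f x a lam))"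

definition viscosity_solution ::
  "(real ^ 'd \<Rightarrow> real ^ 'q \<Rightarrow> real ^ 'd) \<Rightarrow> (real ^ 'd \<Rightarrow> real ^ 'q \<Rightarrow> real ^ 'd ^ 'd)
    \<Rightarrow> (real ^ 'd \<Rightarrow> real ^ 'q \<Rightarrow> real \<Rightarrow> real) \<Rightarrow> (real ^ 'q) set
    \<Rightarrow> real \<Rightarrow> (real ^ 'd \<Rightarrow> real) \<Rightarrow> bool" where
  "viscosity_solution b \<sigma> f A lam \<phi> \<longleftrightarrow>
     continuous_on UNIV \<phi> \<and>
     viscosity_supersolution b \<sigma> f A lam \<phi> \<and> viscosity_subsolution b \<sigma> f A lam \<phi>"

(* S is contained in the topological support of M: every open neighbourhood of
   every point of S is charged by M. *)
definition measure_supports :: "'a::topological_space measure \<Rightarrow> 'a set \<Rightarrow> bool" where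
  "measure_supports M S \<longleftrightarrow>
     (\<forall>x\<in>S. \<forall>U. open U \<longrightarrow> x \<in> U \<longrightarrow> emeasure M (U \<inter> space M) > 0)"

end

theory Submission
  imports Defs "HOL-Complex_Analysis.Great_Picard"
begin

text \<open>
  The solution is the limit of solutions of a monotone finite difference scheme. For a time step
  \<open>h\<close> the diffusion with control \<open>a\<close> is replaced by a random walk that jumps from \<open>x\<close> to
  \<open>x + h b(x,a) + sqrt (h d) \<sigma>(x,a) \<xi>\<close>, where \<open>d\<close> is the dimension and \<open>\<xi>\<close> is uniformly
  distributed on the signed unit vectors. Write \<open>P\<^sub>a v (x)\<close> for the mean of \<open>v\<close> after one jump.

  Driving two walks by the same noise, the dissipativity hypothesis makes the mean square distance
  shrink by the factor \<open>1 - \<gamma> h\<close> when \<open>h\<close> is small, so that \<open>P\<^sub>a\<close> multiplies Lipschitz constants by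
  \<open>1 - \<gamma> h / 2\<close> (\<open>step_lipschitz\<close>). The running gain adds about \<open>L2 h\<close> to a Lipschitz constant.
  The two effects balance at a constant proportional to \<open>L2 / \<gamma>\<close>, which does not depend on \<open>h\<close>: this is the
  estimate on which everything rests. The same hypothesis bounds second moments (\<open>step_second_moment\<close>), which
  makes a multiple of \<open>|x|^2\<close> plus a constant of order \<open>1/h\<close> a barrier from above and below.

  The discounted discrete equation \<open>(1 + h^2) v = sup\<^sub>a (P\<^sub>a v + h f(x, a, h v))\<close> is then solved among
  Lipschitz functions between the two barriers, which form a complete lattice. After damping, the
  operator is monotone on that lattice even though \<open>f\<close> is nonincreasing in its last argument,
  and Tarski's argument gives a fixed point (\<open>discrete_solution_exists\<close>). With \<open>\<phi> = v - v(0)\<close> and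
  \<open>lam = h v(0)\<close>, which is bounded uniformly in \<open>h\<close>, it reads
  \<open>lam = sup\<^sub>a ((P\<^sub>a \<phi> - \<phi>) / h + f(x, a, lam + h \<phi>)) - h \<phi>\<close> (\<open>discrete_ergodic_pair\<close>): discount
  rate and time step vanish together.

  As \<open>h\<close> tends to \<open>0\<close>, the functions \<open>\<phi>\<close> converge locally uniformly and the numbers \<open>lam\<close> converge, both along a
  subsequence. The limit is a viscosity solution by the usual stability argument: touching points of a perturbed
  test function converge to the given touching point (\<open>touching_points_converge\<close>), there the monotone scheme may be
  applied to the test function instead of \<open>\<phi>\<close>, and on test functions it is consistent with the
  generator by Taylor's formula (\<open>noise_mean_consistent\<close>).
\<close>

section \<open>Averages over one jump of the random walk\<close>

text \<open>
  The expectation of \<open>F (m + S \<xi>)\<close> for \<open>\<xi>\<close> uniform on the signed unit vectors. Each coordinate of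
  \<open>\<xi>\<close> has variance \<open>1/d\<close>, which is why the scheme below scales \<open>\<sigma>\<close> by \<open>sqrt (h d)\<close>.
\<close>

definition noise_mean :: "(real ^ 'd \<Rightarrow> real) \<Rightarrow> real ^ 'd \<Rightarrow> real ^ 'd ^ 'd \<Rightarrow> real" where
  "noise_mean F m S =
     (\<Sum>i\<in>UNIV. F (m + column i S) + F (m - column i S)) / (2 * real CARD('d))"

lemma noise_mean_mono:
  assumes "\<And>i. F (m + column i S) \<le> G (m + column i S)"
    and "\<And>i. F (m - column i S) \<le> G (m - column i S)"
  shows "noise_mean F m S \<le> noise_mean G m S"
  unfolding noise_mean_def using assms
  by (intro divide_right_mono sum_mono add_mono) auto

lemma noise_mean_const [simp]: "noise_mean (\<lambda>y. c) m S = c"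
  by (simp add: noise_mean_def)

lemma noise_mean_add: "noise_mean (\<lambda>y. F y + G y) m S = noise_mean F m S + noise_mean G m S"
  unfolding noise_mean_def by (simp add: sum.distrib algebra_simps flip: add_divide_distrib)

lemma noise_mean_diff: "noise_mean (\<lambda>y. F y - G y) m S = noise_mean F m S - noise_mean G m S"
  unfolding noise_mean_def by (simp add: sum.distrib sum_subtractf algebra_simps flip: diff_divide_distrib)

lemma noise_mean_cmult: "noise_mean (\<lambda>y. c * F y) m S = c * noise_mean F m S"
  unfolding noise_mean_def by (simp add: sum_distrib_left algebra_simps sum.distrib)

lemma noise_mean_uminus: "noise_mean (\<lambda>y. - F y) m S = - noise_mean F m S"
  using noise_mean_cmult[of "-1" F m S] by simp

lemma norm_matrix_square_eq_sum_columns: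
  fixes S :: "real ^ 'd ^ 'd"
  shows "(norm S)\<^sup>2 = (\<Sum>i\<in>UNIV. (norm (column i S))\<^sup>2)"
proof -
  have "(norm S)\<^sup>2 = (\<Sum>j\<in>UNIV. \<Sum>i\<in>UNIV. S $ j $ i * S $ j $ i)"
    by (simp add: power2_norm_eq_inner inner_vec_def)
  also have "\<dots> = (\<Sum>i\<in>UNIV. \<Sum>j\<in>UNIV. S $ j $ i * S $ j $ i)"
    by (rule sum.swap)
  finally show ?thesis
    by (simp add: power2_norm_eq_inner inner_vec_def column_def)
qed

lemma column_diff: "column i (S - T) = column i S - column i T"
  and column_scaleR: "column i (c *\<^sub>R S) = c *\<^sub>R column i S"
  by (simp_all add: column_def vec_eq_iff)

lemma norm_column_le: "norm (column i S) \<le> norm (S :: real ^ 'd ^ 'd)"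
proof -
  have "(norm (column i S))\<^sup>2 \<le> (norm S)\<^sup>2"
    unfolding norm_matrix_square_eq_sum_columns by (rule member_le_sum) auto
  then show ?thesis by (simp add: power2_le_iff_abs_le)
qed

text \<open>
  The signed vectors \<open>+v\<close> and \<open>-v\<close> occur with equal weight, so the parallelogram law removes all cross terms.
\<close>

lemma noise_mean_norm_square:
  fixes m :: "real ^ 'd"
  shows "noise_mean (\<lambda>y. (norm y)\<^sup>2) m S = (norm m)\<^sup>2 + (norm S)\<^sup>2 / real CARD('d)"
proof -
  have *: "(norm (m + v))\<^sup>2 + (norm (m - v))\<^sup>2 = 2 * (norm m)\<^sup>2 + 2 * (norm v)\<^sup>2" for v
    by (simp add: power2_norm_eq_inner algebra_simps)
  show ?thesis
    unfolding noise_mean_def * norm_matrix_square_eq_sum_columns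
    by (simp add: sum.distrib add_divide_distrib flip: sum_distrib_left)
qed

text \<open>
  Jensen's inequality, from the nonnegativity of the variance.
\<close>

lemma noise_mean_le_sqrt_second_moment:
  assumes "\<And>i. 0 \<le> F (m + column i S)" "\<And>i. 0 \<le> F (m - column i S)"
  shows "noise_mean F m S \<le> sqrt (noise_mean (\<lambda>y. (F y)\<^sup>2) m S)"
proof -
  let ?E = "noise_mean F m S"
  have "0 \<le> noise_mean (\<lambda>y. (F y - ?E)\<^sup>2) m S"
    using noise_mean_mono[of "\<lambda>_. 0" m S] by fastforce
  also have "\<dots> = noise_mean (\<lambda>y. ((F y)\<^sup>2 - (2 * ?E) * F y) + ?E\<^sup>2) m S"
    by (simp add: power2_diff algebra_simps)
  also have "\<dots> = noise_mean (\<lambda>y. (F y)\<^sup>2) m S - ?E\<^sup>2"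
    unfolding noise_mean_add noise_mean_diff noise_mean_cmult by (simp add: power2_eq_square)
  finally show ?thesis
    by (intro real_le_rsqrt) simp
qed

text \<open>
  Synchronous coupling: both averages use the same noise, so the two jumps end at a
  displacement whose second moment is known exactly.
\<close>

lemma noise_mean_lipschitz:
  fixes m m' :: "real ^ 'd"
  assumes "C-lipschitz_on UNIV v"
  shows "noise_mean v m S - noise_mean v m' S'
           \<le> C * sqrt ((norm (m - m'))\<^sup>2 + (norm (S - S'))\<^sup>2 / real CARD('d))"
proof -
  have C: "C \<ge> 0" and L: "v x - v y \<le> C * norm (x - y)" for x y
    using assms lipschitz_on_nonneg[OF assms] lipschitz_onD[OF assms, of x y]
    by (auto simp: dist_norm)
  have "noise_mean v m S - noise_mean v m' S' \<le> noise_mean (\<lambda>y. C * norm y) (m - m') (S - S')"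
    unfolding noise_mean_def diff_divide_distrib[symmetric] sum_subtractf[symmetric]
  proof (intro divide_right_mono sum_mono)
    fix i
    show "v (m + column i S) + v (m - column i S) - (v (m' + column i S') + v (m' - column i S'))
        \<le> C * norm (m - m' + column i (S - S')) + C * norm (m - m' - column i (S - S'))"
      using L[of "m + column i S" "m' + column i S'"] L[of "m - column i S" "m' - column i S'"]
      by (simp add: column_diff algebra_simps)
  qed simp
  also have "\<dots> \<le> C * sqrt ((norm (m - m'))\<^sup>2 + (norm (S - S'))\<^sup>2 / real CARD('d))"
    unfolding noise_mean_cmult
    using noise_mean_le_sqrt_second_moment[of norm "m - m'" "S - S'"] C
    by (intro mult_left_mono) (auto simp: noise_mean_norm_square)
  finally show ?thesis .
qed

section \<open>Consistency of the averages with second order operators\<close>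

lemma C2_gderiv:
  assumes "C2 \<psi>"
  shows "GDERIV \<psi> x :> grad \<psi> x"
    and "(grad \<psi> has_derivative (\<lambda>v. hess \<psi> x *v v)) (at x)"
proof -
  show "GDERIV \<psi> x :> grad \<psi> x"
    using assms by (intro differentiable_imp_grad) (simp add: C2_def)
  have "grad \<psi> differentiable (at x)"
    using assms by (simp add: C2_def)
  then show "(grad \<psi> has_derivative (\<lambda>v. hess \<psi> x *v v)) (at x)"
    unfolding hess_def by (simp add: jacobian_works)
qed

lemma second_order_taylor:
  assumes "C2 \<psi>"
  shows "\<exists>t\<in>{0<..<1}. \<psi> (x + u) = \<psi> x + u \<bullet> grad \<psi> x
           + 1 / 2 * (u \<bullet> (hess \<psi> (x + t *\<^sub>R u) *v u))"
proof -
  have line: "((\<lambda>t. x + t *\<^sub>R u) has_derivative (\<lambda>s. s *\<^sub>R u)) (at t)" for t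
    by (auto intro!: derivative_eq_intros)
  have d1: "((\<lambda>t. \<psi> (x + t *\<^sub>R u)) has_real_derivative (u \<bullet> grad \<psi> (x + t *\<^sub>R u))) (at t)" for t
  proof -
    have "((\<lambda>t. \<psi> (x + t *\<^sub>R u)) has_derivative (\<lambda>s. (s *\<^sub>R u) \<bullet> grad \<psi> (x + t *\<^sub>R u))) (at t)"
      by (rule has_derivative_compose[OF line C2_gderiv(1)[OF assms, unfolded gderiv_def]])
    moreover have "(\<lambda>s. (s *\<^sub>R u) \<bullet> grad \<psi> (x + t *\<^sub>R u)) = (*) (u \<bullet> grad \<psi> (x + t *\<^sub>R u))"
      by (simp add: fun_eq_iff)
    ultimately show ?thesis
      by (simp add: has_field_derivative_def)
  qed
  have d2: "((\<lambda>t. u \<bullet> grad \<psi> (x + t *\<^sub>R u)) has_real_derivative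
       (u \<bullet> (hess \<psi> (x + t *\<^sub>R u) *v u))) (at t)" for t
  proof -
    have "((\<lambda>t. grad \<psi> (x + t *\<^sub>R u)) has_derivative (\<lambda>s. hess \<psi> (x + t *\<^sub>R u) *v (s *\<^sub>R u))) (at t)"
      by (rule has_derivative_compose[OF line C2_gderiv(2)[OF assms]])
    then have "((\<lambda>t. u \<bullet> grad \<psi> (x + t *\<^sub>R u)) has_derivative
       (\<lambda>s. u \<bullet> (hess \<psi> (x + t *\<^sub>R u) *v (s *\<^sub>R u)))) (at t)"
      by (rule has_derivative_inner_right)
    moreover have "(\<lambda>s. u \<bullet> (hess \<psi> (x + t *\<^sub>R u) *v (s *\<^sub>R u)))
        = (*) (u \<bullet> (hess \<psi> (x + t *\<^sub>R u) *v u))"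
      by (simp add: fun_eq_iff matrix_vector_mult_scaleR)
    ultimately show ?thesis
      by (simp add: has_field_derivative_def)
  qed
  define D :: "nat \<Rightarrow> real \<Rightarrow> real" where
    "D n = (if n = 0 then (\<lambda>t. \<psi> (x + t *\<^sub>R u)) else
     if n = 1 then (\<lambda>t. u \<bullet> grad \<psi> (x + t *\<^sub>R u))
     else (\<lambda>t. u \<bullet> (hess \<psi> (x + t *\<^sub>R u) *v u)))" for n
  have "\<exists>t>0. t < 1 \<and> D 0 1 = (\<Sum>m<2. D m 0 / fact m * 1 ^ m) + D 2 t / fact 2 * 1 ^ 2"
  proof (rule Maclaurin)
    show "\<forall>m t. m < 2 \<and> 0 \<le> t \<and> t \<le> 1 \<longrightarrow> (D m has_real_derivative D (Suc m) t) (at t)"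
    proof (intro allI impI)
      fix m :: nat and t :: real
      assume "m < 2 \<and> 0 \<le> t \<and> t \<le> 1"
      then consider "m = 0" | "m = 1" by linarith
      then show "(D m has_real_derivative D (Suc m) t) (at t)"
        using d1[of t] d2[of t] by cases (simp_all add: D_def)
    qed
  qed simp_all
  then obtain t where t: "0 < t" "t < 1"
    and eq: "D 0 1 = (\<Sum>m<2. D m 0 / fact m * 1 ^ m) + D 2 t / fact 2 * 1 ^ 2"
    by blast
  have "{..<2::nat} = {0, 1}" by auto
  then have "(\<Sum>m<2. D m 0 / fact m * 1 ^ m) = \<psi> x + u \<bullet> grad \<psi> x"
    by (simp add: D_def)
  with eq have "\<psi> (x + u) = \<psi> x + u \<bullet> grad \<psi> x + 1 / 2 * (u \<bullet> (hess \<psi> (x + t *\<^sub>R u) *v u))"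
    by (simp add: D_def)
  with t show ?thesis by (intro bexI[of _ t]) auto
qed

text \<open>
  The jumps of the walk are along the columns of \<open>S\<close>, so the second order term arises in this form.
\<close>

lemma trace_hessian_eq_sum_columns:
  fixes S H :: "real ^ 'd ^ 'd"
  shows "trace (S ** transpose S ** H) = (\<Sum>i\<in>UNIV. column i S \<bullet> (H *v column i S))"
proof -
  have "trace (S ** transpose S ** H) = trace (H ** (S ** transpose S))"
    by (rule trace_mul_sym)
  also have "\<dots> = (\<Sum>j\<in>UNIV. \<Sum>k\<in>UNIV. \<Sum>i\<in>UNIV. H $ j $ k * (S $ k $ i * S $ j $ i))"
    by (simp add: trace_def matrix_matrix_mult_def transpose_def sum_distrib_left)
  also have "\<dots> = (\<Sum>j\<in>UNIV. \<Sum>i\<in>UNIV. \<Sum>k\<in>UNIV. H $ j $ k * (S $ k $ i * S $ j $ i))"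
    by (intro sum.cong refl sum.swap)
  also have "\<dots> = (\<Sum>i\<in>UNIV. \<Sum>j\<in>UNIV. \<Sum>k\<in>UNIV. H $ j $ k * (S $ k $ i * S $ j $ i))"
    by (rule sum.swap)
  also have "\<dots> = (\<Sum>i\<in>UNIV. column i S \<bullet> (H *v column i S))"
    unfolding inner_vec_def matrix_vector_mult_def column_def
    by (intro sum.cong refl) (simp add: sum_distrib_left mult.left_commute mult.commute)
  finally show ?thesis .
qed

lemma tendsto_matrix_vector_mult:
  fixes H :: "'c \<Rightarrow> real ^ 'n ^ 'm"
  assumes "(H \<longlongrightarrow> H0) F" "(v \<longlongrightarrow> v0) F"
  shows "((\<lambda>n. H n *v v n) \<longlongrightarrow> H0 *v v0) F"
  unfolding matrix_vector_mult_def using assms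
  by (intro vec_tendstoI) (auto intro!: tendsto_intros)

lemma tendsto_column:
  fixes S :: "'c \<Rightarrow> real ^ 'n ^ 'm"
  assumes "(S \<longlongrightarrow> S0) F"
  shows "((\<lambda>n. column i (S n)) \<longlongrightarrow> column i S0) F"
  unfolding column_def using assms
  by (intro vec_tendstoI) (auto intro!: tendsto_intros)

text \<open>
  The increment over \<open>u = h p + sqrt h s\<close> is a first order term plus a quadratic form in \<open>u\<close>. After division by
  \<open>h\<close> the quadratic form is evaluated at \<open>u / sqrt h\<close>, which tends to \<open>s\<close>. The part of the first
  order term that has size \<open>sqrt h\<close> would blow up; it is subtracted here, and cancels between
  opposite jumps later.
\<close>

lemma directional_increment_tendsto:
  fixes x :: "real ^ 'd"
  assumes C2: "C2 \<psi>" and xs: "xs \<longlonglongrightarrow> x" and hs: "hs \<longlonglongrightarrow> 0" and hpos: "\<And>n. hs n > 0"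
    and ps: "ps \<longlonglongrightarrow> p" and ss: "ss \<longlonglongrightarrow> s"
  shows "(\<lambda>n. (\<psi> (xs n + hs n *\<^sub>R ps n + sqrt (hs n) *\<^sub>R ss n) - \<psi> (xs n)
            - sqrt (hs n) * (ss n \<bullet> grad \<psi> (xs n))) / hs n)
           \<longlonglongrightarrow> p \<bullet> grad \<psi> x + 1 / 2 * (s \<bullet> (hess \<psi> x *v s))"
proof -
  define w where "w n = sqrt (hs n) *\<^sub>R ps n + ss n" for n
  define u where "u n = sqrt (hs n) *\<^sub>R w n" for n
  have rt: "(\<lambda>n. sqrt (hs n)) \<longlonglongrightarrow> 0"
    using tendsto_real_sqrt[OF hs] by simp
  have w: "w \<longlonglongrightarrow> s"
    unfolding w_def using tendsto_add[OF tendsto_scaleR[OF rt ps] ss] by simp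
  have u: "u \<longlonglongrightarrow> 0"
    unfolding u_def using tendsto_scaleR[OF rt w] by simp
  have "\<forall>n. \<exists>t. 0 < t \<and> t < 1 \<and> \<psi> (xs n + u n) = \<psi> (xs n) + u n \<bullet> grad \<psi> (xs n)
           + 1 / 2 * (u n \<bullet> (hess \<psi> (xs n + t *\<^sub>R u n) *v u n))"
    using second_order_taylor[OF C2] by (simp add: Bex_def conj_assoc)
  then obtain t where t: "\<And>n. 0 < t n \<and> t n < 1"
    and T: "\<And>n. \<psi> (xs n + u n) = \<psi> (xs n) + u n \<bullet> grad \<psi> (xs n)
           + 1 / 2 * (u n \<bullet> (hess \<psi> (xs n + t n *\<^sub>R u n) *v u n))"
    by metis
  have "(\<lambda>n. t n *\<^sub>R u n) \<longlonglongrightarrow> 0"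
  proof (rule Lim_null_comparison[OF _ tendsto_norm_zero[OF u]])
    show "\<forall>\<^sub>F n in sequentially. norm (t n *\<^sub>R u n) \<le> norm (u n)"
      using t by (intro always_eventually allI) (simp add: mult_left_le_one_le less_imp_le)
  qed
  then have xt: "(\<lambda>n. xs n + t n *\<^sub>R u n) \<longlonglongrightarrow> x"
    using tendsto_add[OF xs] by fastforce
  have hc: "isCont (hess \<psi>) x"
    using C2 by (simp add: C2_def continuous_on_eq_continuous_at)
  have gc: "isCont (grad \<psi>) x"
    using C2_gderiv(2)[OF C2] has_derivative_continuous by blast
  have G: "(\<lambda>n. grad \<psi> (xs n)) \<longlonglongrightarrow> grad \<psi> x"
    using isCont_tendsto_compose[OF gc xs] .
  have "(\<lambda>n. ps n \<bullet> grad \<psi> (xs n) + 1 / 2 * (w n \<bullet> (hess \<psi> (xs n + t n *\<^sub>R u n) *v w n)))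
      \<longlonglongrightarrow> p \<bullet> grad \<psi> x + 1 / 2 * (s \<bullet> (hess \<psi> x *v s))"
    by (intro tendsto_intros ps G w tendsto_matrix_vector_mult isCont_tendsto_compose[OF hc xt])
  moreover have "ps n \<bullet> grad \<psi> (xs n) + 1 / 2 * (w n \<bullet> (hess \<psi> (xs n + t n *\<^sub>R u n) *v w n))
     = (\<psi> (xs n + hs n *\<^sub>R ps n + sqrt (hs n) *\<^sub>R ss n) - \<psi> (xs n)
            - sqrt (hs n) * (ss n \<bullet> grad \<psi> (xs n))) / hs n" for n
  proof -
    have hh: "sqrt (hs n) * sqrt (hs n) = hs n" using hpos[of n] by simp
    have uu: "u n = hs n *\<^sub>R ps n + sqrt (hs n) *\<^sub>R ss n"
      by (simp only: u_def w_def scaleR_add_right scaleR_scaleR hh)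
    have q: "u n \<bullet> (hess \<psi> (xs n + t n *\<^sub>R u n) *v u n)
        = hs n * (w n \<bullet> (hess \<psi> (xs n + t n *\<^sub>R u n) *v w n))" (is "_ = hs n * ?q")
    proof -
      have "u n \<bullet> (H *v u n) = hs n * (w n \<bullet> (H *v w n))" for H
        unfolding u_def using hpos[of n]
        by (simp add: matrix_vector_mult_scaleR mult.assoc[symmetric])
      then show ?thesis .
    qed
    have "\<psi> (xs n + hs n *\<^sub>R ps n + sqrt (hs n) *\<^sub>R ss n) = \<psi> (xs n + u n)"
      by (simp add: uu add.assoc)
    also have "\<dots> = \<psi> (xs n) + u n \<bullet> grad \<psi> (xs n) + 1 / 2 * (hs n * ?q)"
      using T[of n] q by simp
    also have "u n \<bullet> grad \<psi> (xs n) = hs n * (ps n \<bullet> grad \<psi> (xs n)) + sqrt (hs n) * (ss n \<bullet> grad \<psi> (xs n))"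
      by (simp add: uu inner_add_left)
    finally show ?thesis
      using hpos[of n] by (simp add: field_simps)
  qed
  ultimately show ?thesis by simp
qed

text \<open>
  The scheme is consistent with the generator: opposite jumps cancel the terms of order \<open>sqrt h\<close>, and
  summing the quadratic forms over the columns of \<open>S\<close> gives the trace term.
\<close>

lemma noise_mean_consistent:
  fixes x :: "real ^ 'd"
  assumes C2: "C2 \<psi>" and xs: "xs \<longlonglongrightarrow> x" and hs: "hs \<longlonglongrightarrow> 0" and hpos: "\<And>n. hs n > 0"
    and ps: "ps \<longlonglongrightarrow> p" and Ss: "Ss \<longlonglongrightarrow> S"
  shows "(\<lambda>n. (noise_mean \<psi> (xs n + hs n *\<^sub>R ps n) (sqrt (hs n * real CARD('d)) *\<^sub>R Ss n) - \<psi> (xs n)) / hs n)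
           \<longlonglongrightarrow> p \<bullet> grad \<psi> x + 1 / 2 * trace (S ** transpose S ** hess \<psi> x)"
proof -
  let ?d = "real CARD('d)"
  define s where "s i n = sqrt ?d *\<^sub>R column i (Ss n)" for i n
  define g where "g i n = (\<psi> (xs n + hs n *\<^sub>R ps n + sqrt (hs n) *\<^sub>R s i n) - \<psi> (xs n)
            - sqrt (hs n) * (s i n \<bullet> grad \<psi> (xs n))) / hs n" for i n
  define g' where "g' i n = (\<psi> (xs n + hs n *\<^sub>R ps n + sqrt (hs n) *\<^sub>R (- s i n)) - \<psi> (xs n)
            - sqrt (hs n) * ((- s i n) \<bullet> grad \<psi> (xs n))) / hs n" for i n
  define q where "q i = column i S \<bullet> (hess \<psi> x *v column i S)" for i
  have s: "s i \<longlonglongrightarrow> sqrt ?d *\<^sub>R column i S" for i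
    unfolding s_def by (intro tendsto_intros tendsto_column Ss)
  have lim: "p \<bullet> grad \<psi> x + 1 / 2 * ((c *\<^sub>R column i S) \<bullet> (hess \<psi> x *v (c *\<^sub>R column i S)))
    = p \<bullet> grad \<psi> x + 1 / 2 * (c\<^sup>2 * q i)" for i c
    by (simp add: q_def matrix_vector_mult_scaleR power2_eq_square)
  have "g i \<longlonglongrightarrow> p \<bullet> grad \<psi> x + 1 / 2 * (?d * q i)" for i
    using directional_increment_tendsto[OF C2 xs hs hpos ps s, of i] lim[of "sqrt ?d" i]
    by (simp add: g_def[abs_def])
  moreover have "g' i \<longlonglongrightarrow> p \<bullet> grad \<psi> x + 1 / 2 * (?d * q i)" for i
  proof -
    have "(\<lambda>n. - s i n) \<longlonglongrightarrow> (- sqrt ?d) *\<^sub>R column i S"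
      using tendsto_minus[OF s] by simp
    from directional_increment_tendsto[OF C2 xs hs hpos ps this] show ?thesis
      unfolding lim g'_def[abs_def] by simp
  qed
  ultimately have "(\<lambda>n. (\<Sum>i\<in>UNIV. g i n + g' i n) / (2 * ?d)) \<longlonglongrightarrow>
     (\<Sum>i\<in>UNIV. (p \<bullet> grad \<psi> x + 1 / 2 * (?d * q i)) + (p \<bullet> grad \<psi> x + 1 / 2 * (?d * q i))) / (2 * ?d)"
    by (intro tendsto_intros) auto
  also have "(\<Sum>i\<in>UNIV. (p \<bullet> grad \<psi> x + 1 / 2 * (?d * q i)) + (p \<bullet> grad \<psi> x + 1 / 2 * (?d * q i))) / (2 * ?d)
     = p \<bullet> grad \<psi> x + 1 / 2 * (\<Sum>i\<in>UNIV. q i)"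
    by (simp add: sum.distrib add_divide_distrib flip: sum_distrib_left sum_distrib_right)
  also have "(\<Sum>i\<in>UNIV. q i) = trace (S ** transpose S ** hess \<psi> x)"
    by (simp add: q_def trace_hessian_eq_sum_columns)
  also have "(\<lambda>n. (\<Sum>i\<in>UNIV. g i n + g' i n) / (2 * ?d)) =
     (\<lambda>n. (noise_mean \<psi> (xs n + hs n *\<^sub>R ps n) (sqrt (hs n * ?d) *\<^sub>R Ss n) - \<psi> (xs n)) / hs n)"
  proof
    fix n
    let ?m = "xs n + hs n *\<^sub>R ps n" and ?T = "sqrt (hs n * ?d) *\<^sub>R Ss n"
    have col: "column i ?T = sqrt (hs n) *\<^sub>R s i n" for i
      by (simp add: s_def column_scaleR real_sqrt_mult)
    have "(\<Sum>i\<in>UNIV. g i n + g' i n)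
      = (\<Sum>i\<in>UNIV. ((\<psi> (?m + column i ?T) + \<psi> (?m - column i ?T)) - 2 * \<psi> (xs n)) / hs n)"
      unfolding g_def g'_def col
      by (intro sum.cong refl) (simp add: diff_divide_distrib add_divide_distrib)
    then show "(\<Sum>i\<in>UNIV. g i n + g' i n) / (2 * ?d) = (noise_mean \<psi> ?m ?T - \<psi> (xs n)) / hs n"
      using hpos[of n]
      by (simp add: noise_mean_def sum_subtractf field_simps flip: sum_divide_distrib)
  qed
  finally show ?thesis .
qed

section \<open>Fixed points and compactness for families of Lipschitz functions\<close>

text \<open>
  Tarski's fixed point theorem for a family of real functions that is a complete lattice under
  pointwise suprema and infima: the supremum of all \<open>v\<close> with \<open>v \<le> T v\<close> is a fixed point. The least element of
  the family is such a \<open>v\<close>.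
\<close>

lemma pointwise_tarski:
  fixes L :: "('a \<Rightarrow> real) set"
  assumes ne: "L \<noteq> {}"
    and bnd: "\<And>v x. v \<in> L \<Longrightarrow> \<bar>v x\<bar> \<le> w x"
    and Sup_closed: "\<And>K. K \<subseteq> L \<Longrightarrow> K \<noteq> {} \<Longrightarrow> (\<lambda>x. SUP v\<in>K. v x) \<in> L"
    and Inf_closed: "\<And>K. K \<subseteq> L \<Longrightarrow> K \<noteq> {} \<Longrightarrow> (\<lambda>x. INF v\<in>K. v x) \<in> L"
    and T: "\<And>v. v \<in> L \<Longrightarrow> T v \<in> L"
    and mono: "\<And>u v. u \<in> L \<Longrightarrow> v \<in> L \<Longrightarrow> u \<le> v \<Longrightarrow> T u \<le> T v"
  shows "\<exists>v\<in>L. T v = v"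
proof -
  (* The least element of the family lies below its image and makes K nonempty. *)
  define bot where "bot = (\<lambda>x. INF v\<in>L. v x)"
  define K where "K = {v \<in> L. v \<le> T v}"
  define V where "V = (\<lambda>x. SUP v\<in>K. v x)"
  have range: "- w x \<le> v x" "v x \<le> w x" if "v \<in> L" for v x
    using bnd[OF that, of x] by linarith+
  have bb: "bdd_below ((\<lambda>v. v x) ` L)" "bdd_above ((\<lambda>v. v x) ` L)" for x
    using range by (auto intro!: bdd_belowI[of _ "- w x"] bdd_aboveI[of _ "w x"])
  have botL: "bot \<in> L"
    unfolding bot_def using ne by (intro Inf_closed) auto
  have "bot \<le> v" if "v \<in> L" for v
    unfolding bot_def le_fun_def using that bb by (auto intro: cINF_lower)
  then have "bot \<in> K"
    using botL T by (simp add: K_def)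
  then have "K \<noteq> {}" by auto
  have "K \<subseteq> L" by (auto simp: K_def)
  have VL: "V \<in> L"
    unfolding V_def by (rule Sup_closed) fact+
  have up: "v \<le> V" if "v \<in> K" for v
    unfolding V_def le_fun_def
    using that bdd_above_mono[OF bb(2) image_mono[OF \<open>K \<subseteq> L\<close>]] by (auto intro: cSUP_upper)
  have "v x \<le> T V x" if "v \<in> K" for v x
  proof -
    have "v x \<le> T v x" using that by (auto simp: K_def le_fun_def)
    also have "\<dots> \<le> T V x"
      using mono[OF _ VL up[OF that]] that by (auto simp: K_def le_fun_def)
    finally show ?thesis .
  qed
  then have le: "V \<le> T V"
    unfolding V_def le_fun_def using \<open>K \<noteq> {}\<close> by (auto intro!: cSUP_least)
  then have "T V \<in> K"
    using VL T mono by (simp add: K_def)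
  then have "T V \<le> V" by (rule up)
  with le have "T V = V" by (intro antisym)
  with VL show ?thesis by blast
qed

lemma lipschitz_on_real_iff:
  fixes v :: "'a::real_normed_vector \<Rightarrow> real"
  assumes "C \<ge> 0"
  shows "C-lipschitz_on UNIV v \<longleftrightarrow> (\<forall>x y. v x - v y \<le> C * norm (x - y))"
proof
  assume *: "C-lipschitz_on UNIV v"
  show "\<forall>x y. v x - v y \<le> C * norm (x - y)"
  proof (intro allI)
    fix x y show "v x - v y \<le> C * norm (x - y)"
      using lipschitz_onD[OF *, of x y] by (auto simp: dist_norm)
  qed
next
  assume *: "\<forall>x y. v x - v y \<le> C * norm (x - y)"
  show "C-lipschitz_on UNIV v"
  proof (rule lipschitz_onI[OF _ assms])
    fix x y
    have "v x - v y \<le> C * norm (x - y)" "v y - v x \<le> C * norm (x - y)"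
      using *[rule_format, of x y] *[rule_format, of y x] by (simp_all add: norm_minus_commute)
    then show "dist (v x) (v y) \<le> C * dist x y"
      by (simp add: dist_norm)
  qed
qed

lemma lipschitz_on_SUP:
  fixes F :: "'i \<Rightarrow> 'a::real_normed_vector \<Rightarrow> real"
  assumes "I \<noteq> {}" "\<And>i. i \<in> I \<Longrightarrow> C-lipschitz_on UNIV (F i)"
    and "\<And>x. bdd_above ((\<lambda>i. F i x) ` I)"
  shows "C-lipschitz_on UNIV (\<lambda>x. SUP i\<in>I. F i x)"
proof -
  obtain i0 where "i0 \<in> I" using assms(1) by auto
  then have C: "C \<ge> 0" using assms(2) lipschitz_on_nonneg by blast
  have "(SUP i\<in>I. F i x) \<le> (SUP i\<in>I. F i y) + C * norm (x - y)" for x y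
  proof (rule cSUP_least[OF assms(1)])
    fix i assume i: "i \<in> I"
    have "F i x \<le> F i y + C * norm (x - y)"
      using assms(2)[OF i] by (simp add: lipschitz_on_real_iff[OF C] algebra_simps)
    also have "F i y \<le> (SUP i\<in>I. F i y)"
      using i assms(3) by (rule cSUP_upper)
    finally show "F i x \<le> (SUP i\<in>I. F i y) + C * norm (x - y)" by simp
  qed
  then show ?thesis by (simp add: lipschitz_on_real_iff[OF C] algebra_simps)
qed

lemma lipschitz_on_INF:
  fixes F :: "'i \<Rightarrow> 'a::real_normed_vector \<Rightarrow> real"
  assumes "I \<noteq> {}" "\<And>i. i \<in> I \<Longrightarrow> C-lipschitz_on UNIV (F i)"
    and "\<And>x. bdd_below ((\<lambda>i. F i x) ` I)"
  shows "C-lipschitz_on UNIV (\<lambda>x. INF i\<in>I. F i x)"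
proof -
  have "(INF i\<in>I. F i x) = - (SUP i\<in>I. - F i x)" for x
    by (simp add: Inf_real_def image_image)
  moreover have "C-lipschitz_on UNIV (\<lambda>x. - (SUP i\<in>I. - F i x))"
    using assms
    by (intro lipschitz_on_minus lipschitz_on_SUP) (auto simp flip: bdd_below_uminus simp: image_image)
  ultimately show ?thesis by simp
qed

text \<open>
  Arzela-Ascoli on the balls of integer radius, followed by a diagonal argument.
\<close>

lemma equi_lipschitz_locally_uniform_subsequence:
  fixes F :: "nat \<Rightarrow> 'a::euclidean_space \<Rightarrow> real"
  assumes lip: "\<And>n. C-lipschitz_on UNIV (F n)" and zero: "\<And>n. F n 0 = 0"
  obtains \<phi> k where "strict_mono (k :: nat \<Rightarrow> nat)" "C-lipschitz_on UNIV \<phi>"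
    and "\<And>R. uniform_limit (cball 0 R) (\<lambda>n. F (k n)) \<phi> sequentially"
proof -
  have C: "C \<ge> 0" using lip lipschitz_on_nonneg by blast
  have L: "\<bar>F n x - F n y\<bar> \<le> C * norm (x - y)" for n x y
    using lipschitz_onD[OF lip, of x y n] by (simp add: dist_norm)
  define P where "P i r \<longleftrightarrow> (\<exists>g. uniform_limit (cball 0 (real i)) (\<lambda>n. F (r n)) g sequentially)"
    for i and r :: "nat \<Rightarrow> nat"
  obtain k where k: "strict_mono (k :: nat \<Rightarrow> nat)" and Pk: "\<And>i. P i (id \<circ> k)"
  proof (rule subsequence_diagonalization_lemma[of P id])
    fix i and r :: "nat \<Rightarrow> nat"
    have bound: "norm (F (r n) x) \<le> C * real i" if "x \<in> cball 0 (real i)" for n x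
    proof -
      have "\<bar>F (r n) x\<bar> \<le> C * norm x" using L[of "r n" x 0] zero by simp
      also have "\<dots> \<le> C * real i" using that C by (intro mult_left_mono) auto
      finally show ?thesis by simp
    qed
    have equi: "\<exists>d. 0 < d \<and> (\<forall>n y. y \<in> cball 0 (real i) \<and> norm (x - y) < d \<longrightarrow> norm (F (r n) x - F (r n) y) < e)"
      if "e > 0" for x e
    proof (intro exI conjI allI impI)
      (* The denominator C + 1 also covers C = 0. *)
      show "0 < e / (C + 1)" using that C by simp
      fix n y assume "y \<in> cball 0 (real i) \<and> norm (x - y) < e / (C + 1)"
      then have "(C + 1) * norm (x - y) < e"
        using C by (simp add: pos_less_divide_eq mult.commute)
      moreover have "C * norm (x - y) \<le> (C + 1) * norm (x - y)"
        by (intro mult_right_mono) auto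
      ultimately show "norm (F (r n) x - F (r n) y) < e" using L[of "r n" x y] by simp
    qed
    obtain g l where l: "strict_mono (l :: nat \<Rightarrow> nat)"
      and conv: "\<And>e. 0 < e \<Longrightarrow> \<exists>N. \<forall>n x. n \<ge> N \<and> x \<in> cball 0 (real i) \<longrightarrow> norm (F (r (l n)) x - g x) < e"
      by (rule Arzela_Ascoli[of "cball 0 (real i)" "\<lambda>n. F (r n)" "C * real i"])
        (use bound equi in auto)
    have "uniform_limit (cball 0 (real i)) (\<lambda>n. F (r (l n))) g sequentially"
      unfolding uniform_limit_sequentially_iff dist_norm using conv by blast
    with l show "\<exists>l. strict_mono (l :: nat \<Rightarrow> nat) \<and> P i (r \<circ> l)"
      unfolding P_def by (intro exI[of _ l] conjI exI[of _ g]) auto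
  next
    fix i and r k1 k2 :: "nat \<Rightarrow> nat" and N
    assume "P i (r \<circ> k1)" and tail: "\<And>j. N \<le> j \<Longrightarrow> \<exists>j'. j \<le> j' \<and> k2 j = k1 j'"
    then obtain g where g: "uniform_limit (cball 0 (real i)) (\<lambda>n. F (r (k1 n))) g sequentially"
      by (auto simp: P_def)
    have "uniform_limit (cball 0 (real i)) (\<lambda>n. F (r (k2 n))) g sequentially"
      unfolding uniform_limit_sequentially_iff
    proof (intro allI impI)
      fix e :: real assume "e > 0"
      then obtain N' where N': "\<And>n x. n \<ge> N' \<Longrightarrow> x \<in> cball 0 (real i) \<Longrightarrow> dist (F (r (k1 n)) x) (g x) < e"
        using g unfolding uniform_limit_sequentially_iff by blast
      show "\<exists>N. \<forall>n\<ge>N. \<forall>x\<in>cball 0 (real i). dist (F (r (k2 n)) x) (g x) < e"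
      proof (intro exI allI impI ballI)
        fix n :: nat and x :: 'a
        assume "max N N' \<le> n" "x \<in> cball 0 (real i)"
        then obtain j where "n \<le> j" "k2 n = k1 j" using tail[of n] by auto
        then show "dist (F (r (k2 n)) x) (g x) < e"
          using N'[of j x] \<open>max N N' \<le> n\<close> \<open>x \<in> cball 0 (real i)\<close> by simp
      qed
    qed
    then show "P i (r \<circ> k2)" by (auto simp: P_def)
  qed blast
  (* The uniform limits on the balls agree where the balls overlap. *)
  define \<phi> where "\<phi> x = lim (\<lambda>n. F (k n) x)" for x
  have lims: "uniform_limit (cball 0 (real i)) (\<lambda>n. F (k n)) \<phi> sequentially" for i
  proof -
    obtain g where g: "uniform_limit (cball 0 (real i)) (\<lambda>n. F (k n)) g sequentially"
      using Pk[of i] by (auto simp: P_def)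
    have "\<phi> x = g x" if "x \<in> cball 0 (real i)" for x
      unfolding \<phi>_def using tendsto_uniform_limitI[OF g that] by (rule limI)
    then show ?thesis
      using g by (subst uniform_limit_cong'[of _ _ "\<lambda>n. F (k n)" _ g]) auto
  qed
  have ul: "uniform_limit (cball 0 R) (\<lambda>n. F (k n)) \<phi> sequentially" for R
  proof -
    obtain i where "R \<le> real i" using real_arch_simple by blast
    then show ?thesis by (intro uniform_limit_on_subset[OF lims[of i]]) auto
  qed
  have pt: "(\<lambda>n. F (k n) x) \<longlonglongrightarrow> \<phi> x" for x
    by (rule tendsto_uniform_limitI[OF ul[of "norm x"]]) simp
  have "C-lipschitz_on UNIV \<phi>"
    unfolding lipschitz_on_real_iff[OF C]
  proof (intro allI)
    fix x y
    have "F (k n) x - F (k n) y \<le> C * norm (x - y)" for n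
      using L[of "k n" x y] by linarith
    then show "\<phi> x - \<phi> y \<le> C * norm (x - y)"
      using tendsto_diff[OF pt[of x] pt[of y]] by (intro LIMSEQ_le_const2) auto
  qed
  then show ?thesis using that k ul by blast
qed

section \<open>Auxiliary facts on continuity and limits\<close>

lemma continuous_imp_semicontinuous:
  assumes "continuous_on UNIV (u :: 'a::topological_space \<Rightarrow> real)"
  shows "lower_semicontinuous u" "upper_semicontinuous u"
proof -
  have "(u \<longlongrightarrow> u x) (at x)" for x
    using assms by (simp add: continuous_on_def)
  then show "lower_semicontinuous u" "upper_semicontinuous u"
    unfolding lower_semicontinuous_def upper_semicontinuous_def
    by (blast intro: order_tendstoD)+
qed

lemma continuous_on_column:
  fixes S :: "'c::topological_space \<Rightarrow> real ^ 'n ^ 'm"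
  assumes "continuous_on B S"
  shows "continuous_on B (\<lambda>x. column i (S x))"
  using assms unfolding continuous_on_def by (auto intro: tendsto_column)

lemma real_le_if_le_add_eps:
  assumes "\<And>\<epsilon>. \<epsilon> > 0 \<Longrightarrow> x \<le> y + \<epsilon> * (c::real)"
  shows "x \<le> y"
proof (rule tendsto_lowerbound)
  show "((\<lambda>\<epsilon>. y + \<epsilon> * c) \<longlongrightarrow> y) (at_right 0)"
    by (auto intro!: tendsto_eq_intros)
  show "\<forall>\<^sub>F \<epsilon> in at_right 0. x \<le> y + \<epsilon> * c"
    using assms by (auto simp: eventually_at_filter)
qed simp

section \<open>The discretized control problem\<close>

text \<open>
  The hypotheses of the theorem with their constants fixed. The bound \<open>\<beta>\<close> on the coefficients at
  the origin comes from the compactness of \<open>A\<close>; together with the Lipschitz bounds it controls their growth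
  uniformly over the controls.
\<close>

locale dissipative_control =
  fixes b :: "real ^ 'd \<Rightarrow> real ^ 'q \<Rightarrow> real ^ 'd"
    and \<sigma> :: "real ^ 'd \<Rightarrow> real ^ 'q \<Rightarrow> real ^ 'd ^ 'd"
    and f :: "real ^ 'd \<Rightarrow> real ^ 'q \<Rightarrow> real \<Rightarrow> real"
    and A :: "(real ^ 'q) set"
    and L1 L2 \<gamma> \<beta> :: real
  assumes A_compact: "compact A" and A_nonempty: "A \<noteq> {}"
    and b_cont: "continuous_on UNIV (\<lambda>(x, a). b x a)"
    and sigma_cont: "continuous_on UNIV (\<lambda>(x, a). \<sigma> x a)"
    and f_cont: "continuous_on UNIV (\<lambda>(x, a, y). f x a y)"
    and b_lip: "norm (b x a - b x' a) \<le> L1 * norm (x - x')"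
    and sigma_lip: "norm (\<sigma> x a - \<sigma> x' a) \<le> L1 * norm (x - x')"
    and dissipative: "a \<in> A \<Longrightarrow> (x - x') \<bullet> (b x a - b x' a) + 1 / 2 * (norm (\<sigma> x a - \<sigma> x' a))\<^sup>2
          \<le> - \<gamma> * (norm (x - x'))\<^sup>2"
    and f_lip: "\<bar>f x a y - f x' a y'\<bar> \<le> L2 * (norm (x - x') + \<bar>y - y'\<bar>)"
    and f_antimono: "antimono (f x a)"
    and pos: "L1 > 0" "L2 > 0" "\<gamma> > 0"
    and at_0: "a \<in> A \<Longrightarrow> norm (b 0 a) \<le> \<beta>" "a \<in> A \<Longrightarrow> norm (\<sigma> 0 a) \<le> \<beta>"
      "a \<in> A \<Longrightarrow> \<bar>f 0 a 0\<bar> \<le> \<beta>"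
begin

text \<open>
  After \<open>0 < h \<le> 1\<close>, the restrictions ensure in turn: \<open>h\<^sup>2 |b|\<^sup>2\<close> is absorbed by the
  dissipation, \<open>1 - \<gamma> h / 2\<close> is nonnegative, the dependence of \<open>f\<close> on \<open>h v\<close> spends at most half of the
  contraction, and the damped operator is monotone.
\<close>

definition small :: "real \<Rightarrow> bool" where
  "small h \<longleftrightarrow> 0 < h \<and> h \<le> 1 \<and> 4 * h * L1\<^sup>2 \<le> \<gamma> \<and> h * \<gamma> \<le> 1 \<and> 4 * h * L2 \<le> \<gamma> \<and> h * L2 \<le> 1"

definition step :: "real \<Rightarrow> real ^ 'q \<Rightarrow> (real ^ 'd \<Rightarrow> real) \<Rightarrow> real ^ 'd \<Rightarrow> real" where
  "step h a v x = noise_mean v (x + h *\<^sub>R b x a) (sqrt (h * real CARD('d)) *\<^sub>R \<sigma> x a)"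

lemma small_pos: "small h \<Longrightarrow> 0 < h"
  by (simp add: small_def)

lemma beta_nonneg: "\<beta> \<ge> 0"
  using A_nonempty at_0(1) norm_ge_zero order_trans by blast

text \<open>
  The constant left over when Young's inequality absorbs the terms linear in \<open>|x|\<close> into
  \<open>\<gamma> |x|\<^sup>2\<close> in the second moment estimate.
\<close>

definition moment_const where "moment_const = 2 * \<beta>\<^sup>2 * (1 + L1)\<^sup>2 / \<gamma> + 3 * \<beta>\<^sup>2"

text \<open>
  The left-hand side is the root mean square distance of two walks with common noise after one
  jump. Dissipativity gives the factor \<open>1 - 2 \<gamma> h\<close> for its square, up to the term \<open>h\<^sup>2 |b - b'|\<^sup>2\<close>
  which costs at most \<open>\<gamma> h\<close>; then \<open>1 - \<gamma> h \<le> (1 - \<gamma> h / 2)\<^sup>2\<close>.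
\<close>

lemma coupled_step_contraction:
  assumes h: "small h" and a: "a \<in> A"
  shows "sqrt ((norm ((x + h *\<^sub>R b x a) - (x' + h *\<^sub>R b x' a)))\<^sup>2 + h * (norm (\<sigma> x a - \<sigma> x' a))\<^sup>2)
     \<le> (1 - \<gamma> * h / 2) * norm (x - x')"
proof (rule real_le_lsqrt)
  have h': "0 < h" "h * \<gamma> \<le> 1" "4 * h * L1\<^sup>2 \<le> \<gamma>"
    using h by (auto simp: small_def)
  show "0 \<le> (1 - \<gamma> * h / 2) * norm (x - x')"
    using h' by (intro mult_nonneg_nonneg) (auto simp: mult.commute)
  define D where "D = b x a - b x' a"
  define r where "r = norm (x - x')"
  have "(norm D)\<^sup>2 \<le> (L1 * r)\<^sup>2"
    unfolding D_def r_def by (intro power_mono b_lip) auto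
  then have D: "(norm D)\<^sup>2 \<le> L1\<^sup>2 * r\<^sup>2"
    by (simp add: power_mult_distrib)
  have h2: "h\<^sup>2 * (norm D)\<^sup>2 \<le> h * (\<gamma> * r\<^sup>2)"
  proof -
    have "h\<^sup>2 * (norm D)\<^sup>2 \<le> h\<^sup>2 * (L1\<^sup>2 * r\<^sup>2)"
      using D by (intro mult_left_mono) auto
    also have "\<dots> = h * ((h * L1\<^sup>2) * r\<^sup>2)" by (simp add: power2_eq_square)
    also have "\<dots> \<le> h * (\<gamma> * r\<^sup>2)"
    proof (intro mult_left_mono mult_right_mono)
      have "0 \<le> h * L1\<^sup>2" using h' by simp
      then show "h * L1\<^sup>2 \<le> \<gamma>" using h' by linarith
    qed (use h' in auto)
    finally show ?thesis .
  qed
  have "(norm ((x + h *\<^sub>R b x a) - (x' + h *\<^sub>R b x' a)))\<^sup>2 = (norm ((x - x') + h *\<^sub>R D))\<^sup>2"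
    by (simp add: D_def algebra_simps)
  also have "\<dots> = r\<^sup>2 + 2 * h * ((x - x') \<bullet> D) + h\<^sup>2 * (norm D)\<^sup>2"
    unfolding r_def power2_norm_eq_inner
    by (simp add: inner_add_left inner_add_right inner_commute power2_eq_square)
  finally have "(norm ((x + h *\<^sub>R b x a) - (x' + h *\<^sub>R b x' a)))\<^sup>2 + h * (norm (\<sigma> x a - \<sigma> x' a))\<^sup>2
     = r\<^sup>2 + 2 * h * ((x - x') \<bullet> D + 1 / 2 * (norm (\<sigma> x a - \<sigma> x' a))\<^sup>2) + h\<^sup>2 * (norm D)\<^sup>2"
    by (simp add: algebra_simps)
  also have "\<dots> \<le> r\<^sup>2 + 2 * h * (- \<gamma> * r\<^sup>2) + h * (\<gamma> * r\<^sup>2)"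
    using dissipative[OF a, of x x'] h2 h'
    by (intro add_mono mult_left_mono) (auto simp: D_def r_def)
  also have "\<dots> = (1 - \<gamma> * h) * r\<^sup>2" by (simp add: algebra_simps)
  also have "\<dots> \<le> (1 - \<gamma> * h / 2)\<^sup>2 * r\<^sup>2"
    by (intro mult_right_mono) (auto simp: power2_diff power_divide)
  finally show "(norm ((x + h *\<^sub>R b x a) - (x' + h *\<^sub>R b x' a)))\<^sup>2 + h * (norm (\<sigma> x a - \<sigma> x' a))\<^sup>2
     \<le> ((1 - \<gamma> * h / 2) * norm (x - x'))\<^sup>2"
    by (simp add: r_def power_mult_distrib)
qed

lemma step_lipschitz:
  assumes h: "small h" and a: "a \<in> A" and v: "C-lipschitz_on UNIV v"
  shows "step h a v x - step h a v x' \<le> C * (1 - \<gamma> * h / 2) * norm (x - x')"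
proof -
  have C: "C \<ge> 0" using v by (rule lipschitz_on_nonneg)
  have "(norm (sqrt (h * real CARD('d)) *\<^sub>R \<sigma> x a - sqrt (h * real CARD('d)) *\<^sub>R \<sigma> x' a))\<^sup>2 / real CARD('d)
     = h * (norm (\<sigma> x a - \<sigma> x' a))\<^sup>2"
    using small_pos[OF h] by (simp add: power_mult_distrib flip: scaleR_diff_right)
  then have "step h a v x - step h a v x'
     \<le> C * sqrt ((norm ((x + h *\<^sub>R b x a) - (x' + h *\<^sub>R b x' a)))\<^sup>2 + h * (norm (\<sigma> x a - \<sigma> x' a))\<^sup>2)"
    unfolding step_def using noise_mean_lipschitz[OF v] by metis
  also have "\<dots> \<le> C * ((1 - \<gamma> * h / 2) * norm (x - x'))"
    by (intro mult_left_mono coupled_step_contraction h a C)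
  finally show ?thesis by (simp add: mult.assoc)
qed

text \<open>
  Used with \<open>z = 0\<close> for moments of the walk, and with \<open>z\<close> a touching point for the quadratic
  penalty that makes a maximum strict.
\<close>

lemma step_norm_square:
  assumes "0 \<le> h"
  shows "step h a (\<lambda>y. (norm (y - z))\<^sup>2) x
    = (norm (x - z))\<^sup>2 + h * (2 * ((x - z) \<bullet> b x a) + h * (norm (b x a))\<^sup>2 + (norm (\<sigma> x a))\<^sup>2)"
proof -
  have shift: "noise_mean (\<lambda>y. F (y - z)) m S = noise_mean F (m - z) S"
    for F m and S :: "real ^ 'd ^ 'd"
    by (simp add: noise_mean_def algebra_simps)
  have eq: "x + h *\<^sub>R b x a - z = (x - z) + h *\<^sub>R b x a" by simp
  have "(norm ((x - z) + h *\<^sub>R b x a))\<^sup>2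
      = (norm (x - z))\<^sup>2 + h * (2 * ((x - z) \<bullet> b x a) + h * (norm (b x a))\<^sup>2)"
    unfolding power2_norm_eq_inner
    by (simp add: inner_add_left inner_add_right inner_commute algebra_simps)
  then show ?thesis
    unfolding step_def shift[of "\<lambda>y. (norm y)\<^sup>2"] noise_mean_norm_square eq
    using assms by (simp add: power_mult_distrib algebra_simps)
qed

text \<open>
  Dissipativity against the point \<open>0\<close> yields \<open>- 2 \<gamma> |x|\<^sup>2\<close>; half of it pays for \<open>h\<^sup>2 |b|\<^sup>2\<close> and for the
  terms linear in \<open>|x|\<close>. The error is of order \<open>h\<close>, and not \<open>sqrt h\<close> as it would be for the
  first moment; this is what keeps the ergodic constant bounded as \<open>h\<close> tends to \<open>0\<close>.
\<close>

lemma step_second_moment: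
  assumes h: "small h" and a: "a \<in> A"
  shows "step h a (\<lambda>y. (norm y)\<^sup>2) x \<le> (norm x)\<^sup>2 + h * (moment_const - \<gamma> * (norm x)\<^sup>2)"
proof -
  define r where "r = norm x"
  define B where "B = b x a - b 0 a"
  define \<Delta> where "\<Delta> = \<sigma> x a - \<sigma> 0 a"
  have h': "0 < h" "h \<le> 1" "4 * h * L1\<^sup>2 \<le> \<gamma>"
    using h by (auto simp: small_def)
  have r: "r \<ge> 0" by (simp add: r_def)
  note \<beta> = beta_nonneg
  have "x \<bullet> B + 1 / 2 * (norm \<Delta>)\<^sup>2 \<le> - \<gamma> * r\<^sup>2"
    using dissipative[OF a, of x 0] by (simp add: B_def \<Delta>_def r_def)
  moreover have "x \<bullet> b x a = x \<bullet> B + x \<bullet> b 0 a"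
    by (simp add: B_def inner_diff_right)
  moreover have "x \<bullet> b 0 a \<le> r * \<beta>"
  proof -
    have "x \<bullet> b 0 a \<le> norm x * norm (b 0 a)" by (rule norm_cauchy_schwarz)
    also have "\<dots> \<le> r * \<beta>" unfolding r_def by (intro mult_left_mono at_0 a) auto
    finally show ?thesis .
  qed
  moreover have "(norm (\<sigma> x a))\<^sup>2 \<le> (norm \<Delta>)\<^sup>2 + 2 * (L1 * r) * \<beta> + \<beta>\<^sup>2"
  proof -
    have "norm \<Delta> \<le> L1 * r"
      using sigma_lip[of x a 0] by (simp add: \<Delta>_def r_def)
    have "(norm (\<sigma> x a))\<^sup>2 \<le> (norm \<Delta> + \<beta>)\<^sup>2"
      using norm_triangle_ineq[of \<Delta> "\<sigma> 0 a"] at_0(2)[OF a]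
      by (intro power_mono) (auto simp: \<Delta>_def)
    also have "\<dots> = (norm \<Delta>)\<^sup>2 + 2 * norm \<Delta> * \<beta> + \<beta>\<^sup>2" by (simp add: power2_sum)
    also have "\<dots> \<le> (norm \<Delta>)\<^sup>2 + 2 * (L1 * r) * \<beta> + \<beta>\<^sup>2"
      using \<open>norm \<Delta> \<le> L1 * r\<close> \<beta> by (intro add_mono mult_right_mono) auto
    finally show ?thesis .
  qed
  moreover have "h * (norm (b x a))\<^sup>2 \<le> \<gamma> / 2 * r\<^sup>2 + 2 * \<beta>\<^sup>2"
  proof -
    have "norm (b x a) \<le> L1 * r + \<beta>"
      using b_lip[of x a 0] at_0(1)[OF a] norm_triangle_ineq[of "b x a - b 0 a" "b 0 a"]
      by (auto simp: r_def)
    then have "(norm (b x a))\<^sup>2 \<le> (L1 * r + \<beta>)\<^sup>2" by (intro power_mono) auto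
    also have "\<dots> \<le> 2 * (L1\<^sup>2 * r\<^sup>2) + 2 * \<beta>\<^sup>2"
      using sum_squares_bound[of "L1 * r" \<beta>] by (simp add: power2_sum power_mult_distrib)
    finally have "h * (norm (b x a))\<^sup>2 \<le> h * (2 * (L1\<^sup>2 * r\<^sup>2) + 2 * \<beta>\<^sup>2)"
      using h' by (intro mult_left_mono) auto
    also have "\<dots> = (2 * h * L1\<^sup>2) * r\<^sup>2 + h * (2 * \<beta>\<^sup>2)" by (simp add: algebra_simps)
    also have "\<dots> \<le> \<gamma> / 2 * r\<^sup>2 + 1 * (2 * \<beta>\<^sup>2)"
      using h' by (intro add_mono mult_right_mono) auto
    finally show ?thesis by simp
  qed
  moreover have "2 * r * \<beta> * (1 + L1) \<le> \<gamma> / 2 * r\<^sup>2 + 2 * \<beta>\<^sup>2 * (1 + L1)\<^sup>2 / \<gamma>"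
  proof -
    (* Young's inequality in the form that leaves half of the available quadratic term. *)
    have "0 \<le> (\<gamma> * r - 2 * \<beta> * (1 + L1))\<^sup>2 / (2 * \<gamma>)" using pos by simp
    also have "\<dots> = \<gamma> / 2 * r\<^sup>2 + 2 * \<beta>\<^sup>2 * (1 + L1)\<^sup>2 / \<gamma> - 2 * r * \<beta> * (1 + L1)"
      using pos by (simp add: field_simps) (simp add: power2_eq_square algebra_simps)
    finally show ?thesis by simp
  qed
  moreover have "2 * r * \<beta> * (1 + L1) = 2 * (r * \<beta>) + 2 * (L1 * r) * \<beta>"
    by (simp add: algebra_simps)
  ultimately have "2 * (x \<bullet> b x a) + h * (norm (b x a))\<^sup>2 + (norm (\<sigma> x a))\<^sup>2 \<le> moment_const - \<gamma> * r\<^sup>2"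
    unfolding moment_const_def by linarith
  then have "h * (2 * (x \<bullet> b x a) + h * (norm (b x a))\<^sup>2 + (norm (\<sigma> x a))\<^sup>2) \<le> h * (moment_const - \<gamma> * r\<^sup>2)"
    using h' by (intro mult_left_mono) auto
  then show ?thesis
    using step_norm_square[of h a 0 x] h' by (simp add: r_def)
qed

lemma continuous_control:
  shows "continuous_on B (\<lambda>a. b x a)" and "continuous_on B (\<lambda>a. \<sigma> x a)"
    and "continuous_on B (\<lambda>a. f x a y)"
  using continuous_on_compose2[OF b_cont, of B "\<lambda>a. (x, a)"]
    continuous_on_compose2[OF sigma_cont, of B "\<lambda>a. (x, a)"]
    continuous_on_compose2[OF f_cont, of B "\<lambda>a. (x, a, y)"]
  by (simp_all add: continuous_on_Pair)

definition gain :: "real \<Rightarrow> real ^ 'q \<Rightarrow> (real ^ 'd \<Rightarrow> real) \<Rightarrow> real ^ 'd \<Rightarrow> real" where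
  "gain h a v x = step h a v x + h * f x a (h * v x)"

lemma continuous_on_gain:
  assumes "continuous_on UNIV v"
  shows "continuous_on B (\<lambda>a. gain h a v x)"
  unfolding gain_def step_def noise_mean_def
  by (intro continuous_intros continuous_on_compose2[OF assms] continuous_on_column continuous_control) auto

lemma gain_bdd_above:
  assumes "continuous_on UNIV v"
  shows "bdd_above ((\<lambda>a. gain h a v x) ` A)"
  using compact_continuous_image[OF continuous_on_gain[OF assms] A_compact]
  by (intro bounded_imp_bdd_above compact_imp_bounded)

text \<open>
  A fixed point of this operator solves \<open>(1 + h\<^sup>2) v = sup\<^sub>a (P\<^sub>a v + h f(x, a, h v))\<close>. The copy of \<open>v\<close>
  added on both sides makes the operator monotone.
\<close>

definition damped :: "real \<Rightarrow> (real ^ 'd \<Rightarrow> real) \<Rightarrow> real ^ 'd \<Rightarrow> real" where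
  "damped h v x = (v x + (SUP a\<in>A. gain h a v x)) / (2 + h\<^sup>2)"

lemma damped_le:
  assumes "\<And>a. a \<in> A \<Longrightarrow> v x + gain h a v x \<le> (2 + h\<^sup>2) * c"
  shows "damped h v x \<le> c"
proof -
  have "(SUP a\<in>A. gain h a v x) \<le> (2 + h\<^sup>2) * c - v x"
    using assms A_nonempty by (intro cSUP_least) (auto simp: le_diff_eq add.commute)
  moreover have "2 + h\<^sup>2 > 0" by (simp add: add_pos_nonneg)
  ultimately show ?thesis by (simp add: damped_def pos_divide_le_eq mult.commute)
qed

lemma le_damped:
  assumes "continuous_on UNIV v" "a \<in> A"
  shows "v x + gain h a v x \<le> (2 + h\<^sup>2) * damped h v x"
proof -
  have "gain h a v x \<le> (SUP a\<in>A. gain h a v x)"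
    using gain_bdd_above[OF assms(1)] assms(2) by (intro cSUP_upper)
  moreover have "2 + h\<^sup>2 > 0" by (simp add: add_pos_nonneg)
  ultimately show ?thesis by (simp add: damped_def)
qed

lemma step_mono: "u \<le> v \<Longrightarrow> step h a u x \<le> step h a v x"
  unfolding step_def by (rule noise_mean_mono) (auto simp: le_fun_def)

text \<open>
  Raising \<open>v\<close> lowers \<open>h f(x, a, h v)\<close>, but by at most \<open>L2 h\<^sup>2\<close> times the increase of \<open>v\<close>, and the
  added copy of \<open>v\<close> compensates for this.
\<close>

lemma damped_mono:
  assumes h: "small h" and cont: "continuous_on UNIV v" and uv: "u \<le> v"
  shows "damped h u \<le> damped h v"
proof (rule le_funI, rule damped_le)
  fix x a assume a: "a \<in> A"
  have h': "0 < h" "h \<le> 1" "h * L2 \<le> 1" using h by (auto simp: small_def)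
  have "u x \<le> v x" using uv by (simp add: le_fun_def)
  have "h * f x a (h * u x) - h * f x a (h * v x) \<le> v x - u x"
  proof -
    have "f x a (h * u x) - f x a (h * v x) \<le> L2 * (h * (v x - u x))"
      using f_lip[of x a "h * u x" x "h * v x"] \<open>u x \<le> v x\<close> h'
      by (simp add: abs_mult flip: right_diff_distrib)
    then have "h * (f x a (h * u x) - f x a (h * v x)) \<le> h * (L2 * (h * (v x - u x)))"
      using h' by (intro mult_left_mono) auto
    also have "\<dots> = ((h * L2) * h) * (v x - u x)" by simp
    also have "\<dots> \<le> 1 * (v x - u x)"
      using h' \<open>u x \<le> v x\<close> by (intro mult_right_mono mult_le_one[OF \<open>h * L2 \<le> 1\<close>]) auto
    finally show ?thesis by (simp add: algebra_simps)
  qed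
  then have "u x + gain h a u x \<le> v x + gain h a v x"
    using step_mono[OF uv, of h a x] by (simp add: gain_def)
  also have "\<dots> \<le> (2 + h\<^sup>2) * damped h v x" by (rule le_damped[OF cont a])
  finally show "u x + gain h a u x \<le> (2 + h\<^sup>2) * damped h v x" .
qed

definition lam_bound where "lam_bound = L2 / \<gamma> * moment_const + L2 + \<beta>"

text \<open>
  The quadratic part outweighs the linear growth of the gain because of the drift towards the
  origin; the discount \<open>h\<^sup>2\<close> applied to the constant \<open>lam_bound / h\<close> yields the term
  \<open>h * lam_bound\<close> that absorbs the remaining errors.
\<close>

definition barrier :: "real \<Rightarrow> real ^ 'd \<Rightarrow> real" where
  "barrier h x = L2 / \<gamma> * (norm x)\<^sup>2 + lam_bound / h"

lemma moment_const_nonneg: "moment_const \<ge> 0"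
  using pos by (simp add: moment_const_def)

lemma lam_bound_nonneg: "lam_bound \<ge> 0"
  using pos moment_const_nonneg beta_nonneg by (simp add: lam_bound_def)

lemma barrier_nonneg: "small h \<Longrightarrow> 0 \<le> barrier h x"
  using pos lam_bound_nonneg by (simp add: barrier_def small_def)

lemma continuous_barrier: "continuous_on UNIV (barrier h)"
  unfolding barrier_def[abs_def] by (intro continuous_intros)

lemma f_growth: "a \<in> A \<Longrightarrow> \<bar>f x a 0\<bar> \<le> L2 * (1 + (norm x)\<^sup>2) + \<beta>"
proof -
  assume a: "a \<in> A"
  have "norm x \<le> 1 + (norm x)\<^sup>2"
  proof -
    have "2 * norm x \<le> 1 + (norm x)\<^sup>2"
      using sum_squares_bound[of 1 "norm x"] by simp
    then show ?thesis
      using norm_ge_zero[of x] by linarith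
  qed
  then have "L2 * norm x \<le> L2 * (1 + (norm x)\<^sup>2)" using pos by simp
  then show ?thesis using f_lip[of x a 0 0 0] at_0(3)[OF a] by simp
qed

lemma step_barrier:
  assumes h: "small h" and a: "a \<in> A"
  shows "step h a (barrier h) x + h * (L2 * (1 + (norm x)\<^sup>2) + \<beta>) \<le> (1 + h\<^sup>2) * barrier h x"
proof -
  have h': "0 < h" using small_pos[OF h] .
  have "step h a (barrier h) x = L2 / \<gamma> * step h a (\<lambda>y. (norm y)\<^sup>2) x + lam_bound / h"
    unfolding step_def barrier_def[abs_def] noise_mean_add noise_mean_cmult by simp
  also have "\<dots> \<le> L2 / \<gamma> * ((norm x)\<^sup>2 + h * (moment_const - \<gamma> * (norm x)\<^sup>2)) + lam_bound / h"
    using pos by (intro add_right_mono mult_left_mono step_second_moment h a) auto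
  finally have "step h a (barrier h) x + h * (L2 * (1 + (norm x)\<^sup>2) + \<beta>) \<le> barrier h x + h * lam_bound"
  proof -
    assume *: "step h a (barrier h) x \<le> L2 / \<gamma> * ((norm x)\<^sup>2 + h * (moment_const - \<gamma> * (norm x)\<^sup>2)) + lam_bound / h"
    define c where "c = L2 / \<gamma>"
    have L2: "L2 = c * \<gamma>" using pos by (simp add: c_def)
    have "c * ((norm x)\<^sup>2 + h * (moment_const - \<gamma> * (norm x)\<^sup>2)) + h * (c * \<gamma> * (1 + (norm x)\<^sup>2) + \<beta>)
      = c * (norm x)\<^sup>2 + h * (c * moment_const + c * \<gamma> + \<beta>)"
      by (simp add: algebra_simps)
    with * show ?thesis
      unfolding barrier_def lam_bound_def c_def[symmetric] L2[symmetric] by linarith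
  qed
  also have "h * lam_bound \<le> h\<^sup>2 * barrier h x"
    using h' pos by (simp add: barrier_def distrib_left power2_eq_square)
  finally show ?thesis by (simp add: distrib_right)
qed

text \<open>
  Since \<open>f\<close> is nonincreasing in its last argument, \<open>f(x, a, 0)\<close> bounds \<open>f\<close> from above on the
  positive barrier and from below on the negative one.
\<close>

lemma damped_barrier:
  assumes h: "small h"
  shows "damped h (barrier h) \<le> barrier h"
    and "(\<lambda>x. - barrier h x) \<le> damped h (\<lambda>x. - barrier h x)"
proof -
  have h': "0 < h" using small_pos[OF h] .
  have w: "0 \<le> h * barrier h x" for x using barrier_nonneg[OF h] h' by simp
  show "damped h (barrier h) \<le> barrier h"
  proof (rule le_funI, rule damped_le)
    fix x a assume a: "a \<in> A"
    have "f x a (h * barrier h x) \<le> f x a 0"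
      using f_antimono w by (rule antimonoD)
    also have "\<dots> \<le> L2 * (1 + (norm x)\<^sup>2) + \<beta>" using f_growth[OF a, of x] by simp
    finally have "h * f x a (h * barrier h x) \<le> h * (L2 * (1 + (norm x)\<^sup>2) + \<beta>)"
      using h' by (intro mult_left_mono) auto
    then show "barrier h x + gain h a (barrier h) x \<le> (2 + h\<^sup>2) * barrier h x"
      using step_barrier[OF h a, of x] by (simp add: gain_def distrib_right)
  qed
  show "(\<lambda>x. - barrier h x) \<le> damped h (\<lambda>x. - barrier h x)"
  proof (rule le_funI)
    fix x
    obtain a where a: "a \<in> A" using A_nonempty by auto
    have "f x a 0 \<le> f x a (h * - barrier h x)"
      using f_antimono w by (intro antimonoD[of "f x a"]) auto
    then have "- (L2 * (1 + (norm x)\<^sup>2) + \<beta>) \<le> f x a (h * - barrier h x)"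
      using f_growth[OF a, of x] by simp
    then have "h * - (L2 * (1 + (norm x)\<^sup>2) + \<beta>) \<le> h * f x a (h * - barrier h x)"
      using h' by (intro mult_left_mono) auto
    then have "- (h * (L2 * (1 + (norm x)\<^sup>2) + \<beta>)) \<le> h * f x a (h * - barrier h x)"
      by (simp only: mult_minus_right)
    moreover have "step h a (\<lambda>x. - barrier h x) x = - step h a (barrier h) x"
      by (simp add: step_def noise_mean_uminus)
    moreover have "(2 + h\<^sup>2) * - barrier h x = - barrier h x - (1 + h\<^sup>2) * barrier h x"
      by (simp add: algebra_simps)
    ultimately have "(2 + h\<^sup>2) * - barrier h x \<le> - barrier h x + gain h a (\<lambda>x. - barrier h x) x"
      using step_barrier[OF h a, of x] unfolding gain_def by linarith
    also have "\<dots> \<le> (2 + h\<^sup>2) * damped h (\<lambda>x. - barrier h x) x"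
      by (intro le_damped[of "\<lambda>x. - barrier h x"] a continuous_intros continuous_barrier)
    finally show "- barrier h x \<le> damped h (\<lambda>x. - barrier h x) x"
      by (subst (asm) mult_le_cancel_left_pos) (simp_all add: add_pos_nonneg)
  qed
qed

text \<open>
  With this constant \<open>C\<close>, the contraction \<open>C \<gamma> / 2\<close> per unit of time covers the
  increase \<open>L2 + h L2 C\<close> due to the running gain, as long as \<open>4 h L2 \<le> \<gamma>\<close>.
\<close>

definition lip_const where "lip_const = 4 * L2 / \<gamma>"

lemma lip_const_nonneg: "lip_const \<ge> 0" using pos by (simp add: lip_const_def)

text \<open>
  The estimate that is uniform in \<open>h\<close>: one jump reduces the Lipschitz constant by \<open>C \<gamma> h / 2\<close>, and
  the running gain restores at most that much.
\<close>

lemma damped_lipschitz: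
  assumes h: "small h" and v: "lip_const-lipschitz_on UNIV v"
  shows "lip_const-lipschitz_on UNIV (damped h v)"
proof -
  have h': "0 < h" "4 * h * L2 \<le> \<gamma>" using h by (auto simp: small_def)
  have cont: "continuous_on UNIV v" using v by (rule lipschitz_on_continuous_on)
  have "damped h v x \<le> damped h v y + lip_const * norm (x - y)" for x y
  proof (rule damped_le)
    fix a assume a: "a \<in> A"
    let ?r = "norm (x - y)"
    have r: "?r \<ge> 0" by simp
    have vxy: "\<bar>v x - v y\<bar> \<le> lip_const * ?r"
      using lipschitz_onD[OF v, of x y] by (simp add: dist_norm)
    have "f x a (h * v x) - f y a (h * v y) \<le> L2 * (?r + h * (lip_const * ?r))"
    proof -
      have "f x a (h * v x) - f y a (h * v y) \<le> L2 * (?r + h * \<bar>v x - v y\<bar>)"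
        using f_lip[of x a "h * v x" y "h * v y"] h' by (simp add: abs_mult flip: right_diff_distrib)
      also have "\<dots> \<le> L2 * (?r + h * (lip_const * ?r))"
        using vxy pos h' by (intro mult_left_mono add_left_mono) auto
      finally show ?thesis .
    qed
    then have "h * (f x a (h * v x) - f y a (h * v y)) \<le> h * (L2 * (?r + h * (lip_const * ?r)))"
      using h' by (intro mult_left_mono) auto
    moreover have "h * (L2 * (?r + h * (lip_const * ?r))) \<le> lip_const * (\<gamma> * h / 2) * ?r"
    proof -
      have "L2 + h * L2 * lip_const \<le> lip_const * (\<gamma> / 2)"
      proof -
        have "h * L2 * lip_const \<le> \<gamma> / 4 * lip_const" using h' lip_const_nonneg by (intro mult_right_mono) auto
        moreover have "L2 = \<gamma> / 4 * lip_const" using pos by (simp add: lip_const_def)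
        ultimately show ?thesis by (simp add: algebra_simps)
      qed
      then have "(h * ?r) * (L2 + h * L2 * lip_const) \<le> (h * ?r) * (lip_const * (\<gamma> / 2))"
        using h' by (intro mult_left_mono) auto
      then show ?thesis by (simp add: algebra_simps)
    qed
    moreover have "step h a v x - step h a v y \<le> lip_const * (1 - \<gamma> * h / 2) * ?r"
      by (rule step_lipschitz[OF h a v])
    moreover have "lip_const * (1 - \<gamma> * h / 2) * ?r + lip_const * (\<gamma> * h / 2) * ?r = lip_const * ?r"
      by (simp add: algebra_simps)
    ultimately have "v x + gain h a v x \<le> v y + gain h a v y + 2 * (lip_const * ?r)"
      using vxy by (simp add: gain_def right_diff_distrib)
    also have "\<dots> \<le> (2 + h\<^sup>2) * damped h v y + (2 + h\<^sup>2) * (lip_const * ?r)"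
      using lip_const_nonneg by (intro add_mono le_damped cont a mult_right_mono) auto
    finally show "v x + gain h a v x \<le> (2 + h\<^sup>2) * (damped h v y + lip_const * ?r)"
      by (simp add: distrib_left)
  qed
  then show ?thesis
    by (simp add: lipschitz_on_real_iff[OF lip_const_nonneg] algebra_simps)
qed

lemma discrete_solution_exists:
  assumes h: "small h"
  shows "\<exists>v. lip_const-lipschitz_on UNIV v \<and> (\<forall>x. \<bar>v x\<bar> \<le> barrier h x) \<and> damped h v = v"
proof -
  define L where "L = {v. lip_const-lipschitz_on UNIV v \<and> (\<forall>x. \<bar>v x\<bar> \<le> barrier h x)}"
  have cont: "continuous_on UNIV v" if "v \<in> L" for v
    using that by (auto simp: L_def intro: lipschitz_on_continuous_on)
  have LI: "v \<in> L" if "lip_const-lipschitz_on UNIV v" "\<And>x. - barrier h x \<le> v x" "\<And>x. v x \<le> barrier h x" for v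
    using that by (auto simp: L_def abs_le_iff minus_le_iff)
  have LD: "lip_const-lipschitz_on UNIV v" "- barrier h x \<le> v x" "v x \<le> barrier h x" if "v \<in> L" for v x
  proof -
    have "\<bar>v x\<bar> \<le> barrier h x" using that by (simp add: L_def)
    then show "- barrier h x \<le> v x" "v x \<le> barrier h x" by linarith+
    show "lip_const-lipschitz_on UNIV v" using that by (simp add: L_def)
  qed
  have "\<exists>v\<in>L. damped h v = v"
  proof (rule pointwise_tarski[where w = "barrier h"])
    have "(\<lambda>x. 0) \<in> L"
      using barrier_nonneg[OF h] lip_const_nonneg by (intro LI) (auto simp: lipschitz_on_real_iff)
    then show "L \<noteq> {}" by auto
    show "\<bar>v x\<bar> \<le> barrier h x" if "v \<in> L" for v x using that by (simp add: L_def)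
    fix S assume S: "S \<subseteq> L" "S \<noteq> {}"
    then obtain s where s: "s \<in> S" by auto
    have ba: "bdd_above ((\<lambda>v. v x) ` S)" and bb: "bdd_below ((\<lambda>v. v x) ` S)" for x
      using S LD(2,3) by (auto intro!: bdd_aboveI[of _ "barrier h x"] bdd_belowI[of _ "- barrier h x"])
    show "(\<lambda>x. SUP v\<in>S. v x) \<in> L"
    proof (rule LI)
      show "lip_const-lipschitz_on UNIV (\<lambda>x. SUP v\<in>S. v x)"
        using S LD(1) ba by (intro lipschitz_on_SUP) auto
      show "- barrier h x \<le> (SUP v\<in>S. v x)" for x
        using cSUP_upper2[OF ba s, of "- barrier h x"] LD(2) S(1) s by auto
      show "(SUP v\<in>S. v x) \<le> barrier h x" for x
        using S LD(3) by (intro cSUP_least) auto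
    qed
    show "(\<lambda>x. INF v\<in>S. v x) \<in> L"
    proof (rule LI)
      show "lip_const-lipschitz_on UNIV (\<lambda>x. INF v\<in>S. v x)"
        using S LD(1) bb by (intro lipschitz_on_INF) auto
      show "(INF v\<in>S. v x) \<le> barrier h x" for x
        using cINF_lower2[OF bb s, of _ "barrier h x"] LD(3) S(1) s by auto
      show "- barrier h x \<le> (INF v\<in>S. v x)" for x
        using S LD(2) by (intro cINF_greatest) auto
    qed
  next
    fix v assume v: "v \<in> L"
    have "damped h v \<le> damped h (barrier h)"
      using LD(3)[OF v] by (intro damped_mono h continuous_barrier) (simp add: le_fun_def)
    moreover have "damped h (\<lambda>x. - barrier h x) \<le> damped h v"
      using LD(2)[OF v] by (intro damped_mono h cont v) (simp add: le_fun_def)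
    ultimately show "damped h v \<in> L"
      using damped_barrier[OF h] damped_lipschitz[OF h LD(1)[OF v]]
      by (intro LI) (auto simp: le_fun_def intro: order_trans)
  next
    show "damped h u \<le> damped h v" if "v \<in> L" "u \<le> v" for u v
      using that by (intro damped_mono h cont)
  qed
  then show ?thesis by (auto simp: L_def)
qed

text \<open>
  Subtracting \<open>v(0)\<close> turns the discount into the constant \<open>lam = h v(0)\<close>, which the barrier bounds
  at the origin.
\<close>

lemma discrete_ergodic_pair:
  assumes h: "small h"
  obtains lam \<phi> where "lip_const-lipschitz_on UNIV \<phi>" "\<phi> 0 = 0" "\<bar>lam\<bar> \<le> lam_bound"
    and "\<And>x a. a \<in> A \<Longrightarrow>
      (step h a \<phi> x - \<phi> x) / h + f x a (lam + h * \<phi> x) - h * \<phi> x \<le> lam"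
    and "\<And>x. \<exists>a\<in>A. lam \<le> (step h a \<phi> x - \<phi> x) / h + f x a (lam + h * \<phi> x) - h * \<phi> x"
proof -
  have h': "0 < h" using small_pos[OF h] .
  obtain v where v: "lip_const-lipschitz_on UNIV v" and bnd: "\<And>x. \<bar>v x\<bar> \<le> barrier h x"
    and fix_v: "damped h v = v"
    using discrete_solution_exists[OF h] by blast
  have cont: "continuous_on UNIV v" using v by (rule lipschitz_on_continuous_on)
  define \<phi> where "\<phi> x = v x - v 0" for x
  define lam where "lam = h * v 0"
  have lh: "lam + h * \<phi> x = h * v x" for x
    by (simp add: lam_def \<phi>_def algebra_simps)
  have st: "step h a \<phi> x - \<phi> x = step h a v x - v x" for a x
    unfolding step_def \<phi>_def[abs_def] noise_mean_diff by simp
  have eq: "(step h a \<phi> x - \<phi> x) / h + f x a (lam + h * \<phi> x) - h * \<phi> x - lam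
      = (v x + gain h a v x - (2 + h\<^sup>2) * v x) / h" for a x
    unfolding lh st gain_def using h'
    by (simp add: lam_def \<phi>_def field_simps power2_eq_square)
  show ?thesis
  proof (rule that)
    show "lip_const-lipschitz_on UNIV \<phi>"
      using v unfolding \<phi>_def[abs_def] by (simp add: lipschitz_on_real_iff[OF lip_const_nonneg])
    show "\<phi> 0 = 0" by (simp add: \<phi>_def)
    show "\<bar>lam\<bar> \<le> lam_bound"
      using bnd[of 0] h' by (simp add: lam_def barrier_def abs_mult pos_le_divide_eq mult.commute)
    show "(step h a \<phi> x - \<phi> x) / h + f x a (lam + h * \<phi> x) - h * \<phi> x \<le> lam" if "a \<in> A" for a x
    proof -
      have "(v x + gain h a v x - (2 + h\<^sup>2) * v x) / h \<le> 0"
        using le_damped[OF cont that, of x h] h' by (simp add: fix_v divide_nonpos_pos)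
      then show ?thesis using eq[of a x] by simp
    qed
    show "\<exists>a\<in>A. lam \<le> (step h a \<phi> x - \<phi> x) / h + f x a (lam + h * \<phi> x) - h * \<phi> x" for x
    proof -
      obtain a where a: "a \<in> A" and max: "\<And>a'. a' \<in> A \<Longrightarrow> gain h a' v x \<le> gain h a v x"
        using continuous_attains_sup[OF A_compact A_nonempty continuous_on_gain[OF cont, of A h x]] by blast
      have "2 + h\<^sup>2 > 0" by (simp add: add_pos_nonneg)
      then have "damped h v x \<le> (v x + gain h a v x) / (2 + h\<^sup>2)"
        using max by (intro damped_le) simp
      then have "(2 + h\<^sup>2) * v x \<le> v x + gain h a v x"
        using \<open>2 + h\<^sup>2 > 0\<close> by (simp add: fix_v pos_le_divide_eq mult.commute)
      then have "0 \<le> (v x + gain h a v x - (2 + h\<^sup>2) * v x) / h" using h' by simp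
      then show ?thesis using a eq[of a x] by (intro bexI[of _ a]) auto
    qed
  qed
qed


section \<open>Stability under vanishing time step\<close>

text \<open>
  The penalty \<open>\<epsilon> |y - x|\<^sup>2\<close> makes the maximum at \<open>x\<close> strict, so maximizers \<open>xs n\<close> of the penalized
  differences on the unit ball tend to \<open>x\<close>. Maximality is needed only at the points that one jump can reach
  from \<open>xs n\<close>, and these stay in the ball for small \<open>h\<close>, uniformly in the control. There, by
  monotonicity, \<open>\<phi>\<close> may be replaced by the test function at the price of the penalty.
\<close>

lemma touching_points_converge:
  assumes cont: "\<And>n. continuous_on UNIV (\<phi>s n)" and ul: "uniform_limit (cball x 1) \<phi>s \<phi> sequentially"
    and \<psi>: "continuous_on UNIV \<psi>" and max: "\<And>y. \<phi> y - \<psi> y \<le> \<phi> x - \<psi> x" and \<epsilon>: "\<epsilon> > 0"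
    and hs: "hs \<longlonglongrightarrow> 0" and hpos: "\<And>n. hs n > 0"
  obtains xs where "xs \<longlonglongrightarrow> x"
    and "\<forall>\<^sub>F n in sequentially. \<forall>a\<in>A.
       step (hs n) a (\<phi>s n) (xs n) - \<phi>s n (xs n) \<le> step (hs n) a \<psi> (xs n) - \<psi> (xs n)
        + \<epsilon> * (hs n * (2 * ((xs n - x) \<bullet> b (xs n) a) + hs n * (norm (b (xs n) a))\<^sup>2
        + (norm (\<sigma> (xs n) a))\<^sup>2))"
proof -
  define G where "G n y = \<phi>s n y - \<psi> y - \<epsilon> * (norm (y - x))\<^sup>2" for n y
  have "\<exists>z\<in>cball x 1. \<forall>y\<in>cball x 1. G n y \<le> G n z" for n
    unfolding G_def
    by (intro continuous_attains_sup continuous_intros continuous_on_subset[OF cont]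
        continuous_on_subset[OF \<psi>]) auto
  then obtain xs where xs: "\<And>n. xs n \<in> cball x 1" and xmax: "\<And>n y. y \<in> cball x 1 \<Longrightarrow> G n y \<le> G n (xs n)"
    by metis
  have lim: "xs \<longlonglongrightarrow> x"
  proof (rule LIMSEQ_I)
    fix e :: real assume "e > 0"
    then have "\<epsilon> * e\<^sup>2 / 2 > 0" using \<epsilon> by simp
    then obtain N where N: "\<And>n y. n \<ge> N \<Longrightarrow> y \<in> cball x 1 \<Longrightarrow> \<bar>\<phi>s n y - \<phi> y\<bar> < \<epsilon> * e\<^sup>2 / 2"
      using ul unfolding uniform_limit_sequentially_iff dist_real_def by blast
    show "\<exists>N. \<forall>n\<ge>N. norm (xs n - x) < e"
    proof (intro exI allI impI)
      fix n assume n: "N \<le> n"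
      have "G n x \<le> G n (xs n)" by (rule xmax) simp
      then have "\<epsilon> * (norm (xs n - x))\<^sup>2 < \<epsilon> * e\<^sup>2"
      proof -
        have "\<bar>\<phi>s n (xs n) - \<phi> (xs n)\<bar> < \<epsilon> * e\<^sup>2 / 2" "\<bar>\<phi>s n x - \<phi> x\<bar> < \<epsilon> * e\<^sup>2 / 2"
          using N[OF n xs] N[OF n, of x] by simp_all
        moreover have "\<phi>s n x - \<psi> x \<le> \<phi>s n (xs n) - \<psi> (xs n) - \<epsilon> * (norm (xs n - x))\<^sup>2"
          using \<open>G n x \<le> G n (xs n)\<close> by (simp add: G_def)
        ultimately show ?thesis using max[of "xs n"] by linarith
      qed
      then have "(norm (xs n - x))\<^sup>2 < e\<^sup>2" using \<epsilon> by simp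
      then show "norm (xs n - x) < e" using \<open>e > 0\<close> by (simp add: power_less_imp_less_base)
    qed
  qed
  (* B bounds both coefficients on the unit ball around x, for all controls. *)
  define B where "B = \<beta> + L1 * (norm x + 1)"
  have ny: "norm y \<le> norm x + 1" if "y \<in> cball x 1" for y
    using that norm_triangle_ineq[of x "y - x"] by (simp add: dist_norm norm_minus_commute)
  have bB: "norm (b y a) \<le> B" and sB: "norm (\<sigma> y a) \<le> B" if "y \<in> cball x 1" "a \<in> A" for y a
  proof -
    have "L1 * norm y \<le> L1 * (norm x + 1)" using ny[OF that(1)] pos by simp
    then show "norm (b y a) \<le> B" "norm (\<sigma> y a) \<le> B"
      using b_lip[of y a 0] sigma_lip[of y a 0] at_0(1,2)[OF that(2)]
        norm_triangle_ineq[of "b y a - b 0 a" "b 0 a"] norm_triangle_ineq[of "\<sigma> y a - \<sigma> 0 a" "\<sigma> 0 a"]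
      by (auto simp: B_def)
  qed
  have "(\<lambda>n. norm (xs n - x) + hs n * B + sqrt (hs n * real CARD('d)) * B)
      \<longlonglongrightarrow> norm (x - x) + 0 * B + sqrt (0 * real CARD('d)) * B"
    by (intro tendsto_intros lim hs)
  then have "\<forall>\<^sub>F n in sequentially. norm (xs n - x) + hs n * B + sqrt (hs n * real CARD('d)) * B < 1"
    by (rule order_tendstoD(2)) simp
  then have "\<forall>\<^sub>F n in sequentially. \<forall>a\<in>A.
       step (hs n) a (\<phi>s n) (xs n) - \<phi>s n (xs n) \<le> step (hs n) a \<psi> (xs n) - \<psi> (xs n)
        + \<epsilon> * (hs n * (2 * ((xs n - x) \<bullet> b (xs n) a) + hs n * (norm (b (xs n) a))\<^sup>2
        + (norm (\<sigma> (xs n) a))\<^sup>2))"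
  proof (rule eventually_mono, intro ballI)
    fix n a
    assume near: "norm (xs n - x) + hs n * B + sqrt (hs n * real CARD('d)) * B < 1" and a: "a \<in> A"
    let ?h = "hs n" and ?x = "xs n"
    let ?m = "?x + ?h *\<^sub>R b ?x a" and ?S = "sqrt (?h * real CARD('d)) *\<^sub>R \<sigma> ?x a"
    have n1: "norm (?h *\<^sub>R b ?x a) \<le> ?h * B"
      using bB[OF xs a] hpos[of n] by simp
    have n2: "norm (column i ?S) \<le> sqrt (?h * real CARD('d)) * B" for i
      using mult_left_mono[OF order_trans[OF norm_column_le[of i "\<sigma> ?x a"] sB[OF xs a]],
          of "sqrt (?h * real CARD('d))"] hpos[of n]
      by (simp add: column_scaleR)
    have in_ball: "?m + v \<in> cball x 1" if "norm v \<le> sqrt (?h * real CARD('d)) * B" for v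
    proof -
      have "norm ((?x - x) + (?h *\<^sub>R b ?x a + v)) \<le> norm (?x - x) + (norm (?h *\<^sub>R b ?x a) + norm v)"
        by (intro norm_triangle_le add_left_mono norm_triangle_ineq)
      also have "\<dots> \<le> 1" using n1 that near by linarith
      finally show ?thesis by (simp add: dist_norm norm_minus_commute algebra_simps)
    qed
    have below: "\<phi>s n y \<le> (\<psi> y + \<epsilon> * (norm (y - x))\<^sup>2) + G n ?x" if "y \<in> cball x 1" for y
      using xmax[OF that, of n] by (simp add: G_def)
    have "step ?h a (\<phi>s n) ?x \<le> noise_mean (\<lambda>y. (\<psi> y + \<epsilon> * (norm (y - x))\<^sup>2) + G n ?x) ?m ?S"
      unfolding step_def
    proof (rule noise_mean_mono)
      fix i
      show "\<phi>s n (?m + column i ?S) \<le> (\<psi> (?m + column i ?S) + \<epsilon> * (norm (?m + column i ?S - x))\<^sup>2) + G n ?x"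
        by (rule below[OF in_ball[OF n2]])
      have "?m - column i ?S \<in> cball x 1"
        using in_ball[of "- column i ?S"] n2[of i] by simp
      then show "\<phi>s n (?m - column i ?S) \<le> (\<psi> (?m - column i ?S) + \<epsilon> * (norm (?m - column i ?S - x))\<^sup>2) + G n ?x"
        by (rule below)
    qed
    also have "\<dots> = step ?h a \<psi> ?x + \<epsilon> * step ?h a (\<lambda>y. (norm (y - x))\<^sup>2) ?x + G n ?x"
      unfolding noise_mean_add noise_mean_cmult noise_mean_const step_def ..
    also have "step ?h a (\<lambda>y. (norm (y - x))\<^sup>2) ?x = (norm (?x - x))\<^sup>2
        + ?h * (2 * ((?x - x) \<bullet> b ?x a) + ?h * (norm (b ?x a))\<^sup>2 + (norm (\<sigma> ?x a))\<^sup>2)"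
      using hpos[of n] by (intro step_norm_square) simp
    finally show "step ?h a (\<phi>s n) ?x - \<phi>s n ?x \<le> step ?h a \<psi> ?x - \<psi> ?x
        + \<epsilon> * (?h * (2 * ((?x - x) \<bullet> b ?x a) + ?h * (norm (b ?x a))\<^sup>2 + (norm (\<sigma> ?x a))\<^sup>2))"
      unfolding G_def by (simp add: distrib_left)
  qed
  with lim show ?thesis by (rule that)
qed

text \<open>
  The limit of the right-hand side of the discrete equation once \<open>\<phi>\<close> has been replaced by
  the test function. The terms with \<open>h \<phi>\<close> vanish because \<open>\<phi>\<close> grows at most linearly.
\<close>

lemma scheme_consistent:
  assumes C2: "C2 \<psi>" and xs: "xs \<longlonglongrightarrow> x" and as: "as \<longlonglongrightarrow> a" and hs: "hs \<longlonglongrightarrow> 0" and hpos: "\<And>n. hs n > 0"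
    and lams: "lams \<longlonglongrightarrow> lam" and \<phi>s: "\<And>n y. \<bar>\<phi>s n y\<bar> \<le> c * norm y"
  shows "(\<lambda>n. (step (hs n) (as n) \<psi> (xs n) - \<psi> (xs n)) / hs n
      + \<epsilon> * (2 * ((xs n - x) \<bullet> b (xs n) (as n)) + hs n * (norm (b (xs n) (as n)))\<^sup>2 + (norm (\<sigma> (xs n) (as n)))\<^sup>2)
      + f (xs n) (as n) (lams n + hs n * \<phi>s n (xs n)) - hs n * \<phi>s n (xs n))
    \<longlonglongrightarrow> generator b \<sigma> a \<psi> x + \<epsilon> * (norm (\<sigma> x a))\<^sup>2 + f x a lam"
proof -
  have bl: "(\<lambda>n. b (xs n) (as n)) \<longlonglongrightarrow> b x a"
    using continuous_on_tendsto_compose[OF b_cont tendsto_Pair[OF xs as]] by simp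
  have sl: "(\<lambda>n. \<sigma> (xs n) (as n)) \<longlonglongrightarrow> \<sigma> x a"
    using continuous_on_tendsto_compose[OF sigma_cont tendsto_Pair[OF xs as]] by simp
  have h\<phi>: "(\<lambda>n. hs n * \<phi>s n (xs n)) \<longlonglongrightarrow> 0"
  proof (rule Lim_null_comparison)
    show "\<forall>\<^sub>F n in sequentially. norm (hs n * \<phi>s n (xs n)) \<le> hs n * (c * norm (xs n))"
      using \<phi>s hpos by (intro always_eventually allI) (simp add: abs_mult less_imp_le)
    have "(\<lambda>n. hs n * (c * norm (xs n))) \<longlonglongrightarrow> 0 * (c * norm x)"
      by (intro tendsto_intros hs xs)
    then show "(\<lambda>n. hs n * (c * norm (xs n))) \<longlonglongrightarrow> 0" by simp
  qed
  have "(\<lambda>n. lams n + hs n * \<phi>s n (xs n)) \<longlonglongrightarrow> lam"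
    using tendsto_add[OF lams h\<phi>] by simp
  then have fl: "(\<lambda>n. f (xs n) (as n) (lams n + hs n * \<phi>s n (xs n))) \<longlonglongrightarrow> f x a lam"
    using continuous_on_tendsto_compose[OF f_cont tendsto_Pair[OF xs tendsto_Pair[OF as]]] by simp
  have "(\<lambda>n. (step (hs n) (as n) \<psi> (xs n) - \<psi> (xs n)) / hs n) \<longlonglongrightarrow> generator b \<sigma> a \<psi> x"
    unfolding step_def generator_def by (rule noise_mean_consistent[OF C2 xs hs hpos bl sl])
  then have "(\<lambda>n. (step (hs n) (as n) \<psi> (xs n) - \<psi> (xs n)) / hs n
      + \<epsilon> * (2 * ((xs n - x) \<bullet> b (xs n) (as n)) + hs n * (norm (b (xs n) (as n)))\<^sup>2 + (norm (\<sigma> (xs n) (as n)))\<^sup>2)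
      + f (xs n) (as n) (lams n + hs n * \<phi>s n (xs n)) - hs n * \<phi>s n (xs n))
    \<longlonglongrightarrow> generator b \<sigma> a \<psi> x + \<epsilon> * (2 * ((x - x) \<bullet> b x a) + 0 * (norm (b x a))\<^sup>2 + (norm (\<sigma> x a))\<^sup>2)
      + f x a lam - 0"
    by (intro tendsto_intros fl h\<phi> bl sl xs hs)
  then show ?thesis by simp
qed

lemma hamiltonian_bdd_above: "bdd_above ((\<lambda>a. generator b \<sigma> a \<psi> x + f x a y) ` A)"
proof -
  have "continuous_on A (\<lambda>a. hess \<psi> x *v column i (\<sigma> x a))" for i
    using continuous_on_column[OF continuous_control(2)[of A x], of i]
    unfolding continuous_on_def by (auto intro: tendsto_matrix_vector_mult)
  then have "continuous_on A (\<lambda>a. generator b \<sigma> a \<psi> x + f x a y)"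
    unfolding generator_def trace_hessian_eq_sum_columns
    by (intro continuous_intros continuous_on_column continuous_control) 
  then show ?thesis
    using compact_continuous_image[OF _ A_compact] by (intro bounded_imp_bdd_above compact_imp_bounded)
qed

context
  fixes hs lams :: "nat \<Rightarrow> real" and \<phi>s :: "nat \<Rightarrow> real ^ 'd \<Rightarrow> real" and \<phi> :: "real ^ 'd \<Rightarrow> real" and lam
  assumes hs: "hs \<longlonglongrightarrow> 0" and hpos: "\<And>n. hs n > 0" and lams: "lams \<longlonglongrightarrow> lam"
    and cont: "\<And>n. continuous_on UNIV (\<phi>s n)" and \<phi>s: "\<And>n y. \<bar>\<phi>s n y\<bar> \<le> lip_const * norm y"
    and ul: "\<And>x R. uniform_limit (cball x R) \<phi>s \<phi> sequentially"
begin

text \<open>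
  The optimal controls at the touching points depend on \<open>n\<close>; by compactness of \<open>A\<close> they converge along a subsequence.
  The penalty leaves an error of at most \<open>\<epsilon> Q\<close>, which vanishes with \<open>\<epsilon>\<close>.
\<close>

lemma limit_subsolution:
  assumes sub: "\<And>n x. \<exists>a\<in>A. lams n \<le> (step (hs n) a (\<phi>s n) x - \<phi>s n x) / hs n
       + f x a (lams n + hs n * \<phi>s n x) - hs n * \<phi>s n x"
    and C2: "C2 \<psi>" and max: "\<And>y. \<phi> y - \<psi> y \<le> \<phi> x - \<psi> x"
  shows "lam \<le> (SUP a\<in>A. generator b \<sigma> a \<psi> x + f x a lam)"
proof -
  have \<psi>: "continuous_on UNIV \<psi>"
    using C2 by (auto simp: C2_def continuous_on_eq_continuous_at differentiable_imp_continuous_within)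
  obtain Q where Q: "\<And>a. a \<in> A \<Longrightarrow> (norm (\<sigma> x a))\<^sup>2 \<le> Q"
  proof -
    have "bdd_above ((\<lambda>a. (norm (\<sigma> x a))\<^sup>2) ` A)"
      by (intro bounded_imp_bdd_above compact_imp_bounded compact_continuous_image A_compact
          continuous_intros continuous_control)
    then show ?thesis using that by (auto simp: bdd_above_def)
  qed
  show ?thesis
  proof (rule real_le_if_le_add_eps[where c = Q])
    fix \<epsilon> :: real assume \<epsilon>: "\<epsilon> > 0"
    obtain xs where xs: "xs \<longlonglongrightarrow> x" and touch: "\<forall>\<^sub>F n in sequentially. \<forall>a\<in>A.
       step (hs n) a (\<phi>s n) (xs n) - \<phi>s n (xs n) \<le> step (hs n) a \<psi> (xs n) - \<psi> (xs n)
        + \<epsilon> * (hs n * (2 * ((xs n - x) \<bullet> b (xs n) a) + hs n * (norm (b (xs n) a))\<^sup>2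
        + (norm (\<sigma> (xs n) a))\<^sup>2))"
      using touching_points_converge[OF cont ul \<psi> max \<epsilon> hs hpos] by blast
    have "\<forall>n. \<exists>a. a \<in> A \<and> lams n \<le> (step (hs n) a (\<phi>s n) (xs n) - \<phi>s n (xs n)) / hs n
       + f (xs n) a (lams n + hs n * \<phi>s n (xs n)) - hs n * \<phi>s n (xs n)"
      using sub by blast
    from choice[OF this] obtain as where asA: "\<And>n. as n \<in> A"
      and as: "\<And>n. lams n \<le> (step (hs n) (as n) (\<phi>s n) (xs n) - \<phi>s n (xs n)) / hs n
       + f (xs n) (as n) (lams n + hs n * \<phi>s n (xs n)) - hs n * \<phi>s n (xs n)"
      by blast
    obtain a r where a: "a \<in> A" and r: "strict_mono (r :: nat \<Rightarrow> nat)" and conv: "(as \<circ> r) \<longlonglongrightarrow> a"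
      using A_compact asA unfolding compact_def by meson
    let ?R = "\<lambda>n. (step (hs n) (as n) \<psi> (xs n) - \<psi> (xs n)) / hs n
      + \<epsilon> * (2 * ((xs n - x) \<bullet> b (xs n) (as n)) + hs n * (norm (b (xs n) (as n)))\<^sup>2 + (norm (\<sigma> (xs n) (as n)))\<^sup>2)
      + f (xs n) (as n) (lams n + hs n * \<phi>s n (xs n)) - hs n * \<phi>s n (xs n)"
    have "\<forall>\<^sub>F n in sequentially. lams n \<le> ?R n"
      using touch
    proof (rule eventually_mono)
      fix n
      let ?e = "2 * ((xs n - x) \<bullet> b (xs n) (as n)) + hs n * (norm (b (xs n) (as n)))\<^sup>2 + (norm (\<sigma> (xs n) (as n)))\<^sup>2"
      assume "\<forall>a\<in>A. step (hs n) a (\<phi>s n) (xs n) - \<phi>s n (xs n) \<le> step (hs n) a \<psi> (xs n) - \<psi> (xs n)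
        + \<epsilon> * (hs n * (2 * ((xs n - x) \<bullet> b (xs n) a) + hs n * (norm (b (xs n) a))\<^sup>2
        + (norm (\<sigma> (xs n) a))\<^sup>2))"
      then have "step (hs n) (as n) (\<phi>s n) (xs n) - \<phi>s n (xs n)
         \<le> step (hs n) (as n) \<psi> (xs n) - \<psi> (xs n) + \<epsilon> * (hs n * ?e)"
        using asA by blast
      then have "(step (hs n) (as n) (\<phi>s n) (xs n) - \<phi>s n (xs n)) / hs n
         \<le> (step (hs n) (as n) \<psi> (xs n) - \<psi> (xs n) + \<epsilon> * (hs n * ?e)) / hs n"
        using hpos[of n] by (intro divide_right_mono) auto
      also have "\<dots> = (step (hs n) (as n) \<psi> (xs n) - \<psi> (xs n)) / hs n + \<epsilon> * ?e"
        using hpos[of n] by (simp add: add_divide_distrib)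
      finally show "lams n \<le> ?R n" using as[of n] by linarith
    qed
    then have ev: "\<forall>\<^sub>F n in sequentially. lams (r n) \<le> ?R (r n)"
      using r by (rule eventually_subseq[rotated])
    have "(\<lambda>n. ?R (r n)) \<longlonglongrightarrow> generator b \<sigma> a \<psi> x + \<epsilon> * (norm (\<sigma> x a))\<^sup>2 + f x a lam"
      using scheme_consistent[OF C2 LIMSEQ_subseq_LIMSEQ[OF xs r] conv LIMSEQ_subseq_LIMSEQ[OF hs r] _
        LIMSEQ_subseq_LIMSEQ[OF lams r], of "\<lambda>n. \<phi>s (r n)" lip_const \<epsilon>] hpos \<phi>s
      by (simp add: o_def)
    then have "lam \<le> generator b \<sigma> a \<psi> x + \<epsilon> * (norm (\<sigma> x a))\<^sup>2 + f x a lam"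
      using LIMSEQ_subseq_LIMSEQ[OF lams r] ev by (intro tendsto_le[OF sequentially_bot]) (auto simp: o_def)
    also have "\<dots> \<le> (generator b \<sigma> a \<psi> x + f x a lam) + \<epsilon> * Q"
      using Q[OF a] \<epsilon> by simp
    also have "generator b \<sigma> a \<psi> x + f x a lam \<le> (SUP a\<in>A. generator b \<sigma> a \<psi> x + f x a lam)"
      by (rule cSUP_upper[OF a hamiltonian_bdd_above])
    finally show "lam \<le> (SUP a\<in>A. generator b \<sigma> a \<psi> x + f x a lam) + \<epsilon> * Q" by simp
  qed
qed

text \<open>
  Here the control is fixed, and the touching argument is applied to \<open>- \<phi>\<close> and \<open>- \<psi>\<close>.
\<close>

lemma limit_supersolution:
  assumes super: "\<And>n x a. a \<in> A \<Longrightarrow> (step (hs n) a (\<phi>s n) x - \<phi>s n x) / hs n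
       + f x a (lams n + hs n * \<phi>s n x) - hs n * \<phi>s n x \<le> lams n"
    and C2: "C2 \<psi>" and min: "\<And>y. \<phi> x - \<psi> x \<le> \<phi> y - \<psi> y"
  shows "(SUP a\<in>A. generator b \<sigma> a \<psi> x + f x a lam) \<le> lam"
proof (rule cSUP_least[OF A_nonempty], rule real_le_if_le_add_eps)
  fix a and \<epsilon> :: real assume a: "a \<in> A" and \<epsilon>: "\<epsilon> > 0"
  have \<psi>: "continuous_on UNIV \<psi>"
    using C2 by (auto simp: C2_def continuous_on_eq_continuous_at differentiable_imp_continuous_within)
  have neg: "step h a (\<lambda>y. - u y) y = - step h a u y" for h a u y
    by (simp add: step_def noise_mean_uminus)
  obtain xs where xs: "xs \<longlonglongrightarrow> x" and touch: "\<forall>\<^sub>F n in sequentially. \<forall>a\<in>A.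
       step (hs n) a (\<lambda>y. - \<phi>s n y) (xs n) - (- \<phi>s n (xs n)) \<le> step (hs n) a (\<lambda>y. - \<psi> y) (xs n) - (- \<psi> (xs n))
        + \<epsilon> * (hs n * (2 * ((xs n - x) \<bullet> b (xs n) a) + hs n * (norm (b (xs n) a))\<^sup>2
        + (norm (\<sigma> (xs n) a))\<^sup>2))"
  proof (rule touching_points_converge[of "\<lambda>n y. - \<phi>s n y" x "\<lambda>y. - \<phi> y" "\<lambda>y. - \<psi> y" \<epsilon> hs])
    show "- \<phi> y - - \<psi> y \<le> - \<phi> x - - \<psi> x" for y using min[of y] by simp
  qed (use cont ul \<psi> \<epsilon> hs hpos in \<open>auto intro!: continuous_intros uniform_limit_intros\<close>)
  let ?R = "\<lambda>n. (step (hs n) a \<psi> (xs n) - \<psi> (xs n)) / hs n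
      + (- \<epsilon>) * (2 * ((xs n - x) \<bullet> b (xs n) a) + hs n * (norm (b (xs n) a))\<^sup>2 + (norm (\<sigma> (xs n) a))\<^sup>2)
      + f (xs n) a (lams n + hs n * \<phi>s n (xs n)) - hs n * \<phi>s n (xs n)"
  have "\<forall>\<^sub>F n in sequentially. ?R n \<le> lams n"
    using touch
  proof (rule eventually_mono)
    fix n
    let ?e = "2 * ((xs n - x) \<bullet> b (xs n) a) + hs n * (norm (b (xs n) a))\<^sup>2 + (norm (\<sigma> (xs n) a))\<^sup>2"
    assume "\<forall>a\<in>A. step (hs n) a (\<lambda>y. - \<phi>s n y) (xs n) - (- \<phi>s n (xs n)) \<le> step (hs n) a (\<lambda>y. - \<psi> y) (xs n) - (- \<psi> (xs n))
        + \<epsilon> * (hs n * (2 * ((xs n - x) \<bullet> b (xs n) a) + hs n * (norm (b (xs n) a))\<^sup>2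
        + (norm (\<sigma> (xs n) a))\<^sup>2))"
    then have "step (hs n) a \<psi> (xs n) - \<psi> (xs n) + (- \<epsilon>) * (hs n * ?e) \<le> step (hs n) a (\<phi>s n) (xs n) - \<phi>s n (xs n)"
      using a unfolding neg by fastforce
    then have "(step (hs n) a \<psi> (xs n) - \<psi> (xs n) + (- \<epsilon>) * (hs n * ?e)) / hs n \<le> (step (hs n) a (\<phi>s n) (xs n) - \<phi>s n (xs n)) / hs n"
      using hpos[of n] by (intro divide_right_mono) auto
    moreover have "(step (hs n) a \<psi> (xs n) - \<psi> (xs n) + (- \<epsilon>) * (hs n * ?e)) / hs n
       = (step (hs n) a \<psi> (xs n) - \<psi> (xs n)) / hs n + (- \<epsilon>) * ?e"
      using hpos[of n] by (simp add: add_divide_distrib diff_divide_distrib)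
    ultimately show "?R n \<le> lams n" using super[OF a, of n "xs n"] by linarith
  qed
  then have "generator b \<sigma> a \<psi> x + (- \<epsilon>) * (norm (\<sigma> x a))\<^sup>2 + f x a lam \<le> lam"
  proof (rule tendsto_le[OF sequentially_bot lams, rotated])
    show "?R \<longlonglongrightarrow> generator b \<sigma> a \<psi> x + (- \<epsilon>) * (norm (\<sigma> x a))\<^sup>2 + f x a lam"
      by (rule scheme_consistent) (fact C2 xs tendsto_const hs hpos lams \<phi>s)+
  qed
  then show "generator b \<sigma> a \<psi> x + f x a lam \<le> lam + \<epsilon> * (norm (\<sigma> x a))\<^sup>2" by simp
qed

end

lemma small_mono: "small h0 \<Longrightarrow> 0 < h \<Longrightarrow> h \<le> h0 \<Longrightarrow> small h"
proof -
  assume h0: "small h0" and h: "0 < h" "h \<le> h0"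
  have "h * c \<le> h0 * c" if "c \<ge> 0" for c using h that by (intro mult_right_mono) auto
  from this[of "4 * L1\<^sup>2"] this[of "4 * L2"] this[of \<gamma>] this[of L2]
  have "h * (4 * L1\<^sup>2) \<le> h0 * (4 * L1\<^sup>2)" "h * (4 * L2) \<le> h0 * (4 * L2)"
    "h * \<gamma> \<le> h0 * \<gamma>" "h * L2 \<le> h0 * L2"
    using pos by auto
  then show "small h"
    using h0 h unfolding small_def by (simp add: mult.assoc mult.left_commute[of 4])
qed

lemma small_exists: "\<exists>h. small h"
proof -
  (* The reciprocal of s satisfies every restriction on the time step at once. *)
  define s where "s = 1 + 4 * L1\<^sup>2 / \<gamma> + \<gamma> + 4 * L2 / \<gamma> + L2"
  have "4 * L1\<^sup>2 / \<gamma> \<ge> 0" "4 * L2 / \<gamma> \<ge> 0" using pos by simp_all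
  then have s: "1 \<le> s" "4 * L1\<^sup>2 / \<gamma> \<le> s" "\<gamma> \<le> s" "4 * L2 / \<gamma> \<le> s" "L2 \<le> s"
    using pos by (simp_all add: s_def)
  then have "4 * L1\<^sup>2 \<le> \<gamma> * s" "4 * L2 \<le> \<gamma> * s"
    using pos by (simp_all add: pos_divide_le_eq mult.commute)
  with s have "small (1 / s)"
    by (simp add: small_def pos_divide_le_eq)
  then show ?thesis ..
qed

lemma ergodic_solution_exists:
  "\<exists>lam \<phi>. (\<exists>C. C-lipschitz_on UNIV \<phi>) \<and> viscosity_solution b \<sigma> f A lam \<phi>"
proof -
  obtain h0 where h0: "small h0" using small_exists by blast
  define h where "h n = h0 / real (Suc n)" for n
  have hsmall: "small (h n)" for n
    using small_pos[OF h0] by (intro small_mono[OF h0]) (auto simp: h_def field_simps)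
  have h_lim: "h \<longlonglongrightarrow> 0"
    unfolding h_def using tendsto_mult[OF tendsto_const[of h0] LIMSEQ_inverse_real_of_nat]
    by (simp add: divide_inverse)
  define good where "good n lam \<phi> \<longleftrightarrow> lip_const-lipschitz_on UNIV \<phi> \<and> \<phi> 0 = 0 \<and> \<bar>lam\<bar> \<le> lam_bound \<and>
     (\<forall>x. \<forall>a\<in>A. (step (h n) a \<phi> x - \<phi> x) / h n + f x a (lam + h n * \<phi> x) - h n * \<phi> x \<le> lam) \<and>
     (\<forall>x. \<exists>a\<in>A. lam \<le> (step (h n) a \<phi> x - \<phi> x) / h n + f x a (lam + h n * \<phi> x) - h n * \<phi> x)"
    for n lam \<phi>
  have "\<exists>lam \<phi>. good n lam \<phi>" for n
  proof (rule discrete_ergodic_pair[OF hsmall[of n]])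
    fix lam \<phi>
    assume "lip_const-lipschitz_on UNIV \<phi>" "\<phi> 0 = 0" "\<bar>lam\<bar> \<le> lam_bound"
      and "\<And>x a. a \<in> A \<Longrightarrow>
        (step (h n) a \<phi> x - \<phi> x) / h n + f x a (lam + h n * \<phi> x) - h n * \<phi> x \<le> lam"
      and "\<And>x. \<exists>a\<in>A. lam \<le> (step (h n) a \<phi> x - \<phi> x) / h n + f x a (lam + h n * \<phi> x) - h n * \<phi> x"
    then have "good n lam \<phi>" by (simp add: good_def)
    then show ?thesis by blast
  qed
  then obtain l0 F where good: "\<And>n. good n (l0 n) (F n)" by metis
  obtain \<phi> k where k: "strict_mono (k :: nat \<Rightarrow> nat)" and \<phi>: "lip_const-lipschitz_on UNIV \<phi>"
    and ul: "\<And>R. uniform_limit (cball 0 R) (\<lambda>n. F (k n)) \<phi> sequentially"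
  proof (rule equi_lipschitz_locally_uniform_subsequence[of lip_const F])
    show "lip_const-lipschitz_on UNIV (F n)" "F n 0 = 0" for n
      using good[of n] by (simp_all add: good_def)
  qed blast
  have "bounded (range (\<lambda>n. l0 (k n)))"
    unfolding bounded_iff using good by (auto simp: good_def)
  then obtain lam r where r: "strict_mono (r :: nat \<Rightarrow> nat)" and lam: "((\<lambda>n. l0 (k n)) \<circ> r) \<longlonglongrightarrow> lam"
    using bounded_imp_convergent_subsequence by blast
  define m where "m n = k (r n)" for n
  have m: "strict_mono m" unfolding m_def using k r by (simp add: strict_mono_def)
  have good': "good (m n) (l0 (m n)) (F (m n))" for n by (rule good)
  have lim1: "(\<lambda>n. h (m n)) \<longlonglongrightarrow> 0"
    using LIMSEQ_subseq_LIMSEQ[OF h_lim m] by (simp add: o_def)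
  have lim2: "(\<lambda>n. l0 (m n)) \<longlonglongrightarrow> lam" using lam by (simp add: o_def m_def)
  have cont: "continuous_on UNIV (F (m n))" for n
    using good' by (auto simp: good_def intro: lipschitz_on_continuous_on)
  have growth: "\<bar>F (m n) y\<bar> \<le> lip_const * norm y" for n y
    using good'[of n] lipschitz_onD[of lip_const UNIV "F (m n)" y 0] by (simp add: good_def dist_norm)
  have ul': "uniform_limit (cball x R) (\<lambda>n. F (m n)) \<phi> sequentially" for x R
  proof -
    have "uniform_limit (cball 0 (norm x + R)) (\<lambda>n. F (m n)) \<phi> sequentially"
      unfolding m_def by (rule filterlim_compose[OF ul filterlim_subseq[OF r]])
    then show ?thesis
    proof (rule uniform_limit_on_subset)
      show "cball x R \<subseteq> cball 0 (norm x + R)"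
      proof
        fix y assume "y \<in> cball x R"
        then show "y \<in> cball 0 (norm x + R)"
          using norm_triangle_ineq[of x "y - x"] by (simp add: dist_norm norm_minus_commute)
      qed
    qed
  qed
  have hp: "h (m n) > 0" for n using small_pos[OF hsmall] .
  have \<phi>c: "continuous_on UNIV \<phi>" using \<phi> by (rule lipschitz_on_continuous_on)
  have "viscosity_subsolution b \<sigma> f A lam \<phi>"
    unfolding viscosity_subsolution_def
  proof (intro conjI allI impI continuous_imp_semicontinuous \<phi>c)
    fix x \<psi> assume "C2 \<psi>" "\<forall>y. \<phi> y - \<psi> y \<le> \<phi> x - \<psi> x"
    then show "lam \<le> (SUP a\<in>A. generator b \<sigma> a \<psi> x + f x a lam)"
      using good' by (intro limit_subsolution[OF lim1 hp lim2 cont growth ul']) (auto simp: good_def)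
  qed
  moreover have "viscosity_supersolution b \<sigma> f A lam \<phi>"
    unfolding viscosity_supersolution_def
  proof (intro conjI allI impI continuous_imp_semicontinuous \<phi>c)
    fix x \<psi> assume "C2 \<psi>" "\<forall>y. \<phi> x - \<psi> x \<le> \<phi> y - \<psi> y"
    then show "(SUP a\<in>A. generator b \<sigma> a \<psi> x + f x a lam) \<le> lam"
      using good' by (intro limit_supersolution[OF lim1 hp lim2 cont growth ul']) (auto simp: good_def)
  qed
  ultimately show ?thesis
    using \<phi> \<phi>c unfolding viscosity_solution_def by blast
qed

end

section \<open>Existence for the ergodic equation\<close>

theorem theorem4p1:
  fixes A :: "(real ^ 'q) set"
    and \<theta> :: "(real ^ 'q) measure"
    and b :: "real ^ 'd \<Rightarrow> real ^ 'q \<Rightarrow> real ^ 'd"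
    and \<sigma> :: "real ^ 'd \<Rightarrow> real ^ 'q \<Rightarrow> real ^ 'd ^ 'd"
    and f :: "real ^ 'd \<Rightarrow> real ^ 'q \<Rightarrow> real \<Rightarrow> real"
  assumes A_compact: "compact A" and A_nonempty: "A \<noteq> {}"
    and finite_theta: "finite_measure \<theta>"
    and sets_theta: "sets \<theta> = sets (restrict_space borel A)"
    and b_cont: "continuous_on UNIV (\<lambda>(x, a). b x a)"
    and sigma_cont: "continuous_on UNIV (\<lambda>(x, a). \<sigma> x a)"
    and f_cont: "continuous_on UNIV (\<lambda>(x, a, y). f x a y)"
    and H1_i: "\<exists>L1>0. \<forall>x x' a a'.
        norm (b x a - b x' a') + norm (\<sigma> x a - \<sigma> x' a') \<le> L1 * (norm (x - x') + norm (a - a'))"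
    and H1_ii: "\<exists>\<gamma>>0. \<forall>x x'. \<forall>a\<in>A.
        (x - x') \<bullet> (b x a - b x' a) + 1 / 2 * (norm (\<sigma> x a - \<sigma> x' a))\<^sup>2
          \<le> - \<gamma> * (norm (x - x'))\<^sup>2"
    and H2_i: "\<exists>L2>0. \<forall>x x' a a' y y'.
        \<bar>f x a y - f x' a' y'\<bar> \<le> L2 * (norm (x - x') + norm (a - a') + \<bar>y - y'\<bar>)"
    and H2_ii: "\<forall>x a. antimono (f x a)"
    and HA: "connected (interior A)" "A = closure (interior A)"
    and Htheta: "measure_supports \<theta> (interior A)" "A - interior A \<in> null_sets \<theta>"
  shows "\<exists>lam \<phi>. (\<exists>C. C-lipschitz_on UNIV \<phi>) \<and> viscosity_solution b \<sigma> f A lam \<phi>"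
proof -
  obtain L1 where L1: "L1 > 0" and L1': "\<And>x x' a a'.
      norm (b x a - b x' a') + norm (\<sigma> x a - \<sigma> x' a') \<le> L1 * (norm (x - x') + norm (a - a'))"
    using H1_i by blast
  obtain L2 where L2: "L2 > 0" and L2': "\<And>x x' a a' y y'.
      \<bar>f x a y - f x' a' y'\<bar> \<le> L2 * (norm (x - x') + norm (a - a') + \<bar>y - y'\<bar>)"
    using H2_i by blast
  obtain \<gamma> where \<gamma>: "\<gamma> > 0" and \<gamma>': "\<And>x x' a. a \<in> A \<Longrightarrow>
      (x - x') \<bullet> (b x a - b x' a) + 1 / 2 * (norm (\<sigma> x a - \<sigma> x' a))\<^sup>2 \<le> - \<gamma> * (norm (x - x'))\<^sup>2"
    using H1_ii by blast
  have "bounded ((\<lambda>a. (b 0 a, \<sigma> 0 a, f 0 a 0)) ` A)"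
  proof (intro compact_imp_bounded compact_continuous_image A_compact continuous_on_Pair)
    show "continuous_on A (\<lambda>a. b 0 a)"
      using continuous_on_compose2[OF b_cont, of A "\<lambda>a. (0, a)"] by (simp add: continuous_on_Pair)
    show "continuous_on A (\<lambda>a. \<sigma> 0 a)"
      using continuous_on_compose2[OF sigma_cont, of A "\<lambda>a. (0, a)"] by (simp add: continuous_on_Pair)
    show "continuous_on A (\<lambda>a. f 0 a 0)"
      using continuous_on_compose2[OF f_cont, of A "\<lambda>a. (0, a, 0)"] by (simp add: continuous_on_Pair)
  qed
  then obtain \<beta> where \<beta>: "\<And>a. a \<in> A \<Longrightarrow> norm (b 0 a, \<sigma> 0 a, f 0 a 0) \<le> \<beta>"
    unfolding bounded_iff by blast
  interpret dissipative_control b \<sigma> f A L1 L2 \<gamma> \<beta>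
  proof
    fix x x' a
    show "norm (b x a - b x' a) \<le> L1 * norm (x - x')" "norm (\<sigma> x a - \<sigma> x' a) \<le> L1 * norm (x - x')"
    proof -
      have "norm (b x a - b x' a) + norm (\<sigma> x a - \<sigma> x' a) \<le> L1 * norm (x - x')"
        using L1'[of x a x' a] by simp
      then show "norm (b x a - b x' a) \<le> L1 * norm (x - x')" "norm (\<sigma> x a - \<sigma> x' a) \<le> L1 * norm (x - x')"
        using norm_ge_zero[of "b x a - b x' a"] norm_ge_zero[of "\<sigma> x a - \<sigma> x' a"] by linarith+
    qed
  next
    fix a assume a: "a \<in> A"
    show "norm (b 0 a) \<le> \<beta>"
      using norm_fst_le[of "b 0 a"] \<beta>[OF a] order_trans by blast
    have "norm (\<sigma> 0 a, f 0 a 0) \<le> \<beta>"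
      using norm_snd_le[of "(\<sigma> 0 a, f 0 a 0)"] \<beta>[OF a] order_trans by blast
    then show "norm (\<sigma> 0 a) \<le> \<beta>" "\<bar>f 0 a 0\<bar> \<le> \<beta>"
      using norm_fst_le[of "\<sigma> 0 a" "f 0 a 0"] norm_snd_le[of "f 0 a 0" "\<sigma> 0 a"] by auto
  next
    show "\<bar>f x a y - f x' a y'\<bar> \<le> L2 * (norm (x - x') + \<bar>y - y'\<bar>)" for x a y x' y'
      using L2'[of x a y x' a y'] by simp
  qed (use A_compact A_nonempty b_cont sigma_cont f_cont \<gamma>' H2_ii L1 L2 \<gamma> in auto)
  show ?thesis by (rule ergodic_solution_exists)
qed

end
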